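(* Let $k$ be a field, $R=k[x,y]$, and $I=(x^d,y^d,x^by^{d-b})$ with $d\ge2$, $1\le b\le d-b$ and $\gcd(d,b)=1$. Then the Rees algebra $\mathcal R_R(I)$ is almost Cohen--Macaulay, and it is Cohen--Macaulay if and only if $d=2$.
   Context: For an ideal $I\subset k[x,y]$, the Rees algebra $\mathcal R_R(I)=R[IT]$ has dimension $3$; it is almost Cohen--Macaulay if its depth (at the maximal homogeneous ideal) is at least $2$. *)

theory Defs
  imports Main "HOL-Library.Poly_Mapping" "HOL-Library.Extended_Nat"
begin

text \<open>Polynomials over a field k in the variables X0 = x, X1 = y, X2 = t
  (the ambient ring k[x,y,t] containing R = k[x,y] and the Rees algebra R[It]).\<close>

type_synonym 'k mpoly = "(nat \<Rightarrow>\<^sub>0 nat) \<Rightarrow>\<^sub>0 'k"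

definition Var :: "nat \<Rightarrow> 'k::comm_ring_1 mpoly" where
  "Var i = Poly_Mapping.single (Poly_Mapping.single i 1) 1"

definition Const :: "'k::comm_ring_1 \<Rightarrow> 'k mpoly" where
  "Const c = Poly_Mapping.single 0 c"

abbreviation Xv :: "'k::comm_ring_1 mpoly" where "Xv \<equiv> Var 0"
abbreviation Yv :: "'k::comm_ring_1 mpoly" where "Yv \<equiv> Var 1"
abbreviation Tv :: "'k::comm_ring_1 mpoly" where "Tv \<equiv> Var 2"

inductive_set k_alg :: "'k::comm_ring_1 mpoly set \<Rightarrow> 'k mpoly set" for G where
  const: "Const c \<in> k_alg G"
| gen: "g \<in> G \<Longrightarrow> g \<in> k_alg G"
| add: "a \<in> k_alg G \<Longrightarrow> b \<in> k_alg G \<Longrightarrow> a + b \<in> k_alg G"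
| mult: "a \<in> k_alg G \<Longrightarrow> b \<in> k_alg G \<Longrightarrow> a * b \<in> k_alg G"

inductive_set ideal_gen :: "'k::comm_ring_1 mpoly set \<Rightarrow> 'k mpoly set \<Rightarrow> 'k mpoly set"
  for A S where
  zero: "0 \<in> ideal_gen A S"
| step: "a \<in> A \<Longrightarrow> s \<in> S \<Longrightarrow> j \<in> ideal_gen A S \<Longrightarrow> a * s + j \<in> ideal_gen A S"

definition polyR :: "'k::field mpoly set" where
  "polyR = k_alg {Xv, Yv}"

definition idealI :: "nat \<Rightarrow> nat \<Rightarrow> 'k::field mpoly set" where
  "idealI d b = ideal_gen polyR {Xv ^ d, Yv ^ d, Xv ^ b * Yv ^ (d - b)}"

definition rees :: "nat \<Rightarrow> nat \<Rightarrow> 'k::field mpoly set" where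
  "rees d b = k_alg ({Xv, Yv} \<union> {f * Tv | f. f \<in> idealI d b})"

definition rees_max :: "nat \<Rightarrow> nat \<Rightarrow> 'k::field mpoly set" where
  "rees_max d b = ideal_gen (rees d b) ({Xv, Yv} \<union> {f * Tv | f. f \<in> idealI d b})"

definition regular_seq :: "'k::comm_ring_1 mpoly set \<Rightarrow> 'k mpoly set \<Rightarrow> 'k mpoly list \<Rightarrow> bool" where
  "regular_seq A M fs \<longleftrightarrow> set fs \<subseteq> M \<and>
     (\<forall>i < length fs. \<forall>a \<in> A. fs ! i * a \<in> ideal_gen A (set (take i fs))
          \<longrightarrow> a \<in> ideal_gen A (set (take i fs))) \<and>
     1 \<notin> ideal_gen A (set fs)"

definition depth :: "'k::comm_ring_1 mpoly set \<Rightarrow> 'k mpoly set \<Rightarrow> enat" where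
  "depth A M = Sup {enat (length fs) | fs. regular_seq A M fs}"

definition prime_ideal_in :: "'k::comm_ring_1 mpoly set \<Rightarrow> 'k mpoly set \<Rightarrow> bool" where
  "prime_ideal_in A P \<longleftrightarrow> P \<subseteq> A \<and> 0 \<in> P \<and>
     (\<forall>a\<in>P. \<forall>b\<in>P. a + b \<in> P) \<and> (\<forall>a\<in>A. \<forall>p\<in>P. a * p \<in> P) \<and> 1 \<notin> P \<and>
     (\<forall>a\<in>A. \<forall>b\<in>A. a * b \<in> P \<longrightarrow> a \<in> P \<or> b \<in> P)"

definition krull_dim :: "'k::comm_ring_1 mpoly set \<Rightarrow> enat" where
  "krull_dim A = Sup {enat n | n. \<exists>P :: nat \<Rightarrow> 'k mpoly set.
      (\<forall>i \<le> n. prime_ideal_in A (P i)) \<and> (\<forall>i < n. P i \<subset> P (Suc i))}"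

definition almost_CM :: "'k::comm_ring_1 mpoly set \<Rightarrow> 'k mpoly set \<Rightarrow> bool" where
  "almost_CM A M \<longleftrightarrow> depth A M \<ge> 2"

text \<open>Cohen-Macaulay for the positively graded algebra A with maximal homogeneous ideal M.\<close>
definition CM :: "'k::comm_ring_1 mpoly set \<Rightarrow> 'k mpoly set \<Rightarrow> bool" where
  "CM A M \<longleftrightarrow> depth A M = krull_dim A"

end

theory Submission
  imports Defs
begin

text \<open>
  The Rees algebra is spanned by the monomials \<open>x\<^sup>i y\<^sup>j t\<^sup>n\<close> with \<open>x\<^sup>i y\<^sup>j \<in> I\<^sup>n\<close>. With the
  numerical semigroups \<open>\<langle>d, b\<rangle>\<close> and \<open>\<langle>d, d - b\<rangle>\<close> this means that \<open>[dn - j, i]\<close> meets the first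
  and \<open>[dn - i, j]\<close> meets the second. The first condition is invariant under multiplication by
  \<open>y\<^sup>d t\<close>, the second under multiplication by \<open>x\<^sup>d t\<close>, whence \<open>x, (x\<^sup>d + y\<^sup>d) t\<close> is a regular
  sequence. For \<open>d \<ge> 3\<close> the fraction \<open>y\<^bsup>d-b-1\<^esup> / x\<close> represents a nonzero socle element of the
  second local cohomology, so no regular sequence has length three. For \<open>d = 2\<close> the sequence
  \<open>x, y\<^sup>2 t, y + x\<^sup>2 t\<close> is regular. Depth and dimension are at most three because four
  elements of \<open>k[x, y, t]\<close> are algebraically dependent, and the dimension is at least three by
  an explicit chain of monomial primes.
\<close>

section \<open>Trivariate monomials and their spans\<close>

abbreviation lkp :: "('a \<Rightarrow>\<^sub>0 'b::zero) \<Rightarrow> 'a \<Rightarrow> 'b" where "lkp \<equiv> Poly_Mapping.lookup"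

text \<open>A polynomial is the sum of the single terms at its keys. The \<open>single\<close> case
  ranges over keys of \<open>p\<close> only, so that a support condition on \<open>p\<close> reaches
  the induction, as in \<open>mspan_induct\<close>.\<close>

lemma poly_mapping_additive_induct [case_names zero add single]:
  fixes p :: "'a \<Rightarrow>\<^sub>0 'b::comm_monoid_add"
  assumes "P 0" and "\<And>p q. P p \<Longrightarrow> P q \<Longrightarrow> P (p + q)"
    and "\<And>\<kappa> c. \<kappa> \<in> Poly_Mapping.keys p \<Longrightarrow> P (Poly_Mapping.single \<kappa> c)"
  shows "P p"
proof -
  have "P (sum (\<lambda>\<kappa>. Poly_Mapping.single \<kappa> (lkp p \<kappa>)) F)"
    if "finite F" "F \<subseteq> Poly_Mapping.keys p" for F
    using that by (induction F) (use assms in auto)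
  moreover have "sum (\<lambda>\<kappa>. Poly_Mapping.single \<kappa> (lkp p \<kappa>)) (Poly_Mapping.keys p) = p"
    by (rule poly_mapping_eqI)
      (auto simp: lookup_sum lookup_single when_def in_keys_iff sum.delta'
        intro: sum.neutral)
  ultimately show ?thesis by (metis finite_keys order_refl)
qed

definition mexp :: "nat \<Rightarrow> nat \<Rightarrow> nat \<Rightarrow> (nat \<Rightarrow>\<^sub>0 nat)" where
  "mexp i j n = Poly_Mapping.single 0 i + Poly_Mapping.single 1 j + Poly_Mapping.single 2 n"

definition monom :: "nat \<Rightarrow> nat \<Rightarrow> nat \<Rightarrow> 'k::comm_ring_1 mpoly" where
  "monom i j n = Poly_Mapping.single (mexp i j n) 1"

definition mcoeff :: "'k::comm_ring_1 mpoly \<Rightarrow> nat \<Rightarrow> nat \<Rightarrow> nat \<Rightarrow> 'k" where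
  "mcoeff p i j n = lkp p (mexp i j n)"

text \<open>The \<open>k\<close>-span of the monomials with exponents in \<open>Q\<close>, encoded
  through supports so that membership can be checked coefficient by coefficient.\<close>

definition mspan :: "(nat \<Rightarrow> nat \<Rightarrow> nat \<Rightarrow> bool) \<Rightarrow> 'k::comm_ring_1 mpoly set" where
  "mspan Q = {p. Poly_Mapping.keys p \<subseteq> {mexp i j n | i j n. Q i j n}}"

lemma lookup_mexp:
  "lkp (mexp i j n) v = (if v = 0 then i else if v = 1 then j else if v = 2 then n else 0)"
  by (auto simp: mexp_def lookup_add lookup_single when_def)

lemma mexp_inject [simp]: "mexp i j n = mexp i' j' n' \<longleftrightarrow> i = i' \<and> j = j' \<and> n = n'"
proof
  assume "mexp i j n = mexp i' j' n'"
  then have "lkp (mexp i j n) v = lkp (mexp i' j' n') v" for v by simp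
  from this[of 0] this[of 1] this[of 2] show "i = i' \<and> j = j' \<and> n = n'"
    by (simp add: lookup_mexp)
qed simp

lemma mexp_add: "mexp i j n + mexp i' j' n' = mexp (i + i') (j + j') (n + n')"
  by (rule poly_mapping_eqI) (simp add: lookup_add lookup_mexp)

lemma mexp_zero: "mexp 0 0 0 = 0"
  by (simp add: mexp_def)

lemma monom_mult: "monom i j n * monom i' j' n' = monom (i + i') (j + j') (n + n')"
  by (simp add: monom_def mult_single mexp_add)

lemma monom_zero: "monom 0 0 0 = 1"
  by (simp add: monom_def mexp_zero)

lemma monom_power: "monom i j n ^ m = monom (m * i) (m * j) (m * n)"
  by (induction m) (simp_all add: monom_mult monom_zero)

lemma Var_monom: "Var 0 = monom 1 0 0" "Var 1 = monom 0 1 0" "Var (Suc 0) = monom 0 1 0"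
  "Var 2 = monom 0 0 1"
  by (simp_all add: Var_def monom_def mexp_def)

lemma monom_neq_0: "monom i j n \<noteq> (0 :: 'k::field mpoly)"
  by (simp add: monom_def single_zero poly_mapping_eq_iff fun_eq_iff lookup_single)
    (metis when_simps(1) zero_neq_one)

lemma lookup_single_mult_shift:
  fixes p :: "'k::comm_ring_1 mpoly"
  shows "lkp (Poly_Mapping.single \<mu> 1 * p) (\<mu> + \<kappa>) = lkp p \<kappa>"
  by (induction p rule: poly_mapping_additive_induct)
    (auto simp: lookup_add distrib_left mult_single lookup_single when_def)

lemma lookup_single_mult_outside:
  fixes p :: "'k::comm_ring_1 mpoly"
  assumes "\<And>\<kappa>'. \<kappa> \<noteq> \<mu> + \<kappa>'"
  shows "lkp (Poly_Mapping.single \<mu> 1 * p) \<kappa> = 0"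
  by (induction p rule: poly_mapping_additive_induct)
    (use assms in \<open>auto simp: lookup_add distrib_left mult_single lookup_single when_def\<close>)

lemma mcoeff_monom_mult:
  "mcoeff (monom a b c * p) i j n =
     (if a \<le> i \<and> b \<le> j \<and> c \<le> n then mcoeff p (i - a) (j - b) (n - c) else 0)"
proof (cases "a \<le> i \<and> b \<le> j \<and> c \<le> n")
  case True
  then have "mexp i j n = mexp a b c + mexp (i - a) (j - b) (n - c)"
    by (simp add: mexp_add)
  then show ?thesis
    using True by (simp add: mcoeff_def monom_def lookup_single_mult_shift)
next
  case False
  have "mexp i j n \<noteq> mexp a b c + \<kappa>" for \<kappa>
  proof
    assume "mexp i j n = mexp a b c + \<kappa>"
    then have "lkp (mexp i j n) v = lkp (mexp a b c) v + lkp \<kappa> v" for v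
      by (simp add: lookup_add)
    from this[of 0] this[of 1] this[of 2] False show False
      by (auto simp: lookup_mexp)
  qed
  then have "lkp (Poly_Mapping.single (mexp a b c) 1 * p) (mexp i j n) = 0"
    by (rule lookup_single_mult_outside)
  with False show ?thesis by (auto simp: mcoeff_def monom_def)
qed

lemma mcoeff_add: "mcoeff (p + q) i j n = mcoeff p i j n + mcoeff q i j n"
  by (simp add: mcoeff_def lookup_add)

lemma mcoeff_monom: "mcoeff (monom a b c) i j n = (if a = i \<and> b = j \<and> c = n then 1 else 0)"
  by (auto simp: mcoeff_def monom_def lookup_single when_def)

lemma mspan_zero: "0 \<in> mspan Q"
  by (simp add: mspan_def)

lemma mspan_add: "p \<in> mspan Q \<Longrightarrow> q \<in> mspan Q \<Longrightarrow> p + q \<in> mspan Q"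
  unfolding mspan_def using keys_add[of p q] by auto

lemma mspan_uminus: "p \<in> mspan Q \<Longrightarrow> - p \<in> mspan Q"
  by (simp add: mspan_def in_keys_iff subset_iff)

lemma mspan_diff: "p \<in> mspan Q \<Longrightarrow> q \<in> mspan Q \<Longrightarrow> p - q \<in> mspan Q"
  using mspan_add[of p Q "- q"] mspan_uminus[of q Q] by simp

lemma mspan_monom: "Q i j n \<Longrightarrow> monom i j n \<in> mspan Q"
  by (auto simp: mspan_def monom_def)

lemma mspan_Const_monom: "Q i j n \<Longrightarrow> Const c * monom i j n \<in> mspan Q"
  by (auto simp: mspan_def monom_def Const_def mult_single)

lemma mspan_mult:
  assumes "\<And>i j n i' j' n'. Q i j n \<Longrightarrow> Q' i' j' n' \<Longrightarrow> Q'' (i + i') (j + j') (n + n')"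
    and "p \<in> mspan Q" "q \<in> mspan Q'"
  shows "p * q \<in> mspan Q''"
  unfolding mspan_def
proof (rule CollectI, rule subsetI)
  fix \<kappa> assume "\<kappa> \<in> Poly_Mapping.keys (p * q)"
  then obtain u v where "u \<in> Poly_Mapping.keys p" "v \<in> Poly_Mapping.keys q" "\<kappa> = u + v"
    using keys_mult[of p q] by auto
  moreover from this obtain i j n i' j' n' where
    "u = mexp i j n" "Q i j n" "v = mexp i' j' n'" "Q' i' j' n'"
    using assms(2,3) unfolding mspan_def by blast
  ultimately have "\<kappa> = mexp (i + i') (j + j') (n + n')" "Q'' (i + i') (j + j') (n + n')"
    using assms(1) by (simp_all add: mexp_add)
  then show "\<kappa> \<in> {mexp i j n |i j n. Q'' i j n}" by blast
qed

lemma mspan_mcoeff: "p \<in> mspan Q \<Longrightarrow> mcoeff p i j n \<noteq> 0 \<Longrightarrow> Q i j n"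
  unfolding mspan_def mcoeff_def by (auto simp flip: in_keys_iff)

lemma mspan_restrict:
  assumes "p \<in> mspan Q" "\<And>i j n. Q i j n \<Longrightarrow> mcoeff p i j n \<noteq> 0 \<Longrightarrow> Q' i j n"
  shows "p \<in> mspan Q'"
  using assms unfolding mspan_def mcoeff_def by (fastforce simp flip: in_keys_iff)

lemma mspan_weaken: "p \<in> mspan Q \<Longrightarrow> (\<And>i j n. Q i j n \<Longrightarrow> Q' i j n) \<Longrightarrow> p \<in> mspan Q'"
  using mspan_restrict by metis

lemma mspan_induct [consumes 1, case_names zero add monom]:
  assumes "p \<in> mspan Q" and "P 0" and "\<And>p q. P p \<Longrightarrow> P q \<Longrightarrow> P (p + q)"
    and "\<And>c i j n. Q i j n \<Longrightarrow> P (Const c * monom i j n)"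
  shows "P p"
proof (induction p rule: poly_mapping_additive_induct)
  case (single \<kappa> c)
  then obtain i j n where "\<kappa> = mexp i j n" "Q i j n"
    using assms(1) by (auto simp: mspan_def)
  then show ?case using assms(4)[of i j n c] by (simp add: Const_def monom_def mult_single)
qed (use assms in auto)

text \<open>Divisibility by a monomial is a condition on the support, since each term can be divided
  separately. Regularity and ideal membership below are reduced to exponents in this way.\<close>

lemma mspan_divide:
  assumes "p \<in> mspan Q"
    and "\<And>i j n. mcoeff p i j n \<noteq> 0 \<Longrightarrow>
      a \<le> i \<and> b \<le> j \<and> c \<le> n \<and> Q' (i - a) (j - b) (n - c)"
  shows "\<exists>q \<in> mspan Q'. p = monom a b c * q"
proof -
  have "p \<in> mspan (\<lambda>i j n. a \<le> i \<and> b \<le> j \<and> c \<le> n \<and> Q' (i - a) (j - b) (n - c))"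
    using assms by (rule mspan_restrict)
  then show ?thesis
  proof (induction rule: mspan_induct)
    case zero
    show ?case using mspan_zero by force
  next
    case (add p q)
    then show ?case using mspan_add by (metis distrib_left)
  next
    case (monom e i j n)
    then have "Const e * monom i j n = monom a b c * (Const e * monom (i - a) (j - b) (n - c))"
      by (simp add: mult.left_commute[of "monom a b c"] monom_mult)
    moreover have "Const e * monom (i - a) (j - b) (n - c) \<in> mspan Q'"
      using monom by (intro mspan_Const_monom) simp
    ultimately show ?case by metis
  qed
qed

lemma mspan_split:
  assumes "p \<in> mspan (\<lambda>i j n. Q i j n \<or> Q' i j n)"
  shows "\<exists>u \<in> mspan Q. \<exists>v \<in> mspan Q'. p = u + v"
  using assms
proof (induction rule: mspan_induct)
  case zero
  show ?case using mspan_zero by force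
next
  case (add p q)
  then obtain u v u' v' where "u \<in> mspan Q" "v \<in> mspan Q'" "p = u + v"
    "u' \<in> mspan Q" "v' \<in> mspan Q'" "q = u' + v'" by auto
  then show ?case
    by (intro bexI[of _ "u + u'"] bexI[of _ "v + v'"]) (auto simp: mspan_add)
next
  case (monom e i j n)
  then consider "Q i j n" | "Q' i j n" by blast
  then show ?case
  proof cases
    case 1
    then show ?thesis
      by (intro bexI[of _ "Const e * monom i j n"] bexI[of _ 0]) (auto simp: mspan_Const_monom mspan_zero)
  next
    case 2
    then show ?thesis
      by (intro bexI[of _ 0] bexI[of _ "Const e * monom i j n"]) (auto simp: mspan_Const_monom mspan_zero)
  qed
qed

section \<open>The Rees algebra as a monomial algebra\<close>

text \<open>\<open>p\<close>, \<open>q\<close>, \<open>r\<close> count the factors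
  \<open>x^d\<close>, \<open>y^d\<close>, \<open>x^b y^(d-b)\<close> in a generator of the
  \<open>n\<close>-th power of \<open>I\<close> that divides \<open>x^i y^j\<close>.\<close>

definition rees_exp :: "nat \<Rightarrow> nat \<Rightarrow> nat \<Rightarrow> nat \<Rightarrow> nat \<Rightarrow> bool" where
  "rees_exp d b i j n \<longleftrightarrow>
     (\<exists>p q r. p + q + r = n \<and> d * p + b * r \<le> i \<and> d * q + (d - b) * r \<le> j)"

text \<open>The interval \<open>[dn - j, i]\<close> meets the semigroup generated by
  \<open>d\<close> and \<open>b\<close>, written without truncated subtraction. The number of
  summands \<open>p + r\<close> may exceed \<open>n\<close>.\<close>

definition half_exp :: "nat \<Rightarrow> nat \<Rightarrow> nat \<Rightarrow> nat \<Rightarrow> nat \<Rightarrow> bool" where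
  "half_exp d b i j n \<longleftrightarrow> (\<exists>p r. d * p + b * r \<le> i \<and> d * n \<le> j + (d * p + b * r))"

definition rees_exp_pos :: "nat \<Rightarrow> nat \<Rightarrow> nat \<Rightarrow> nat \<Rightarrow> nat \<Rightarrow> bool" where
  "rees_exp_pos d b i j n \<longleftrightarrow> rees_exp d b i j n \<and> (i \<noteq> 0 \<or> j \<noteq> 0 \<or> n \<noteq> 0)"

text \<open>Forwards, \<open>dn\<close> is the sum of the \<open>x\<close>-degree and the
  \<open>y\<close>-degree of the generator. Backwards, a semigroup element with at most
  \<open>n\<close> summands is completed to a generator by copies of \<open>y^d\<close>,
  respectively \<open>x^d\<close>. If both elements have more than \<open>n\<close> summands, then
  \<open>bn \<le> i\<close> and \<open>(d-b)n \<le> j\<close>, and the \<open>n\<close>-th power of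
  \<open>x^b y^(d-b)\<close> divides.\<close>

lemma rees_exp_iff_half_exp:
  assumes "b \<le> d"
  shows "rees_exp d b i j n \<longleftrightarrow> half_exp d b i j n \<and> half_exp d (d - b) j i n"
proof
  assume "rees_exp d b i j n"
  then obtain p q r where n: "p + q + r = n" and i: "d * p + b * r \<le> i"
    and j: "d * q + (d - b) * r \<le> j" unfolding rees_exp_def by blast
  have "d * r = b * r + (d - b) * r" using assms by (simp flip: distrib_right)
  moreover have "d * n = d * p + d * q + d * r" by (simp add: distrib_left flip: n)
  ultimately have "d * n = (d * p + b * r) + (d * q + (d - b) * r)" by linarith
  with i j show "half_exp d b i j n \<and> half_exp d (d - b) j i n"
    unfolding half_exp_def by (intro conjI exI[of _ p] exI[of _ q] exI[of _ r]) auto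
next
  assume "half_exp d b i j n \<and> half_exp d (d - b) j i n"
  then obtain p r q s where i: "d * p + b * r \<le> i" "d * n \<le> j + (d * p + b * r)"
    and j: "d * q + (d - b) * s \<le> j" "d * n \<le> i + (d * q + (d - b) * s)"
    unfolding half_exp_def by blast
  have split: "d * m = b * m + (d - b) * m" for m using assms by (simp flip: distrib_right)
  consider "p + r \<le> n" | "q + s \<le> n" | "n < p + r" "n < q + s" by linarith
  then show "rees_exp d b i j n"
  proof cases
    case 1
    then obtain m where "n = p + r + m" using le_Suc_ex by blast
    moreover from this have "d * n = d * p + d * r + d * m" by (simp add: distrib_left)
    then have "d * m + (d - b) * r \<le> j" using i split[of r] by linarith
    ultimately show ?thesis unfolding rees_exp_def using i
      by (intro exI[of _ p] exI[of _ m] exI[of _ r]) simp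
  next
    case 2
    then obtain m where "n = q + s + m" using le_Suc_ex by blast
    moreover from this have "d * n = d * q + d * s + d * m" by (simp add: distrib_left)
    then have "d * m + b * s \<le> i" using j split[of s] by linarith
    ultimately show ?thesis unfolding rees_exp_def using j
      by (intro exI[of _ m] exI[of _ q] exI[of _ s]) simp
  next
    case 3
    have "b * n \<le> b * (p + r)" "(d - b) * n \<le> (d - b) * (q + s)"
      using 3 by (intro mult_le_mono2; simp)+
    moreover have "b * p \<le> d * p" "(d - b) * q \<le> d * q" using assms by simp_all
    ultimately have "b * n \<le> i" "(d - b) * n \<le> j"
      using i(1) j(1) unfolding distrib_left by linarith+
    then show ?thesis unfolding rees_exp_def
      by (intro exI[of _ 0] exI[of _ n]) auto
  qed
qed

text \<open>The interval \<open>[dn - j, i]\<close> does not change under multiplication by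
  \<open>y^d t\<close>, so the first half of the condition on a monomial can be tested after such a
  multiplication.\<close>

lemma half_exp_shift: "half_exp d b i (j + d) (Suc n) \<longleftrightarrow> half_exp d b i j n"
  by (simp add: half_exp_def algebra_simps)

text \<open>Trading \<open>y^d\<close> for \<open>x^d\<close> shifts the interval up by
  \<open>d\<close>, and adding \<open>d\<close> to the semigroup element follows it.\<close>

lemma half_exp_transfer: "half_exp d b i (j + d) n \<Longrightarrow> half_exp d b (i + d) j n"
proof -
  assume "half_exp d b i (j + d) n"
  then obtain p r where "d * p + b * r \<le> i" "d * n \<le> j + d + (d * p + b * r)"
    unfolding half_exp_def by blast
  then show ?thesis unfolding half_exp_def by (intro exI[of _ "Suc p"] exI[of _ r]) auto
qed

lemma rees_exp_zero [simp]: "rees_exp d b i j 0"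
  by (simp add: rees_exp_def)

lemma rees_exp_add:
  assumes "rees_exp d b i j n" "rees_exp d b i' j' n'"
  shows "rees_exp d b (i + i') (j + j') (n + n')"
proof -
  from assms obtain p q r p' q' r' where
    "p + q + r = n" "d * p + b * r \<le> i" "d * q + (d - b) * r \<le> j"
    "p' + q' + r' = n'" "d * p' + b * r' \<le> i'" "d * q' + (d - b) * r' \<le> j'"
    unfolding rees_exp_def by blast
  then show ?thesis unfolding rees_exp_def
    by (intro exI[of _ "p + p'"] exI[of _ "q + q'"] exI[of _ "r + r'"])
      (simp add: distrib_left)
qed

lemma rees_exp_gens:
  shows "rees_exp d b d 0 1" "rees_exp d b 0 d 1" "rees_exp d b b (d - b) 1"
proof -
  show "rees_exp d b d 0 1" unfolding rees_exp_def by (intro exI[of _ 1] exI[of _ 0]) auto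
  show "rees_exp d b 0 d 1" unfolding rees_exp_def
    by (rule exI[of _ 0], rule exI[of _ 1], rule exI[of _ 0]) auto
  show "rees_exp d b b (d - b) 1" unfolding rees_exp_def
    by (rule exI[of _ 0], rule exI[of _ 0], rule exI[of _ 1]) auto
qed

lemma Const_mspan: "Q 0 0 0 \<Longrightarrow> Const c \<in> mspan Q"
  using mspan_Const_monom[of Q 0 0 0 c] by (simp add: monom_zero)

lemma k_alg_power: "a \<in> k_alg G \<Longrightarrow> a ^ m \<in> k_alg G"
proof (induction m)
  case 0
  show ?case using k_alg.const[of 1 G] by (simp add: Const_def)
qed (simp add: k_alg.mult)

lemma polyR_subset: "polyR \<subseteq> (mspan (\<lambda>i j n. n = 0) :: 'k::field mpoly set)"
proof
  fix f :: "'k mpoly" assume "f \<in> polyR"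
  then show "f \<in> mspan (\<lambda>i j n. n = 0)" unfolding polyR_def
  proof induction
    case (const c) then show ?case by (simp add: Const_mspan)
  next
    case (gen g) then show ?case by (auto simp: Var_monom intro: mspan_monom)
  next
    case (add f g) then show ?case by (simp add: mspan_add)
  next
    case (mult f g) then show ?case by (auto intro: mspan_mult[rotated])
  qed
qed

lemma idealI_subset:
  "idealI d b \<subseteq> (mspan (\<lambda>i j n. n = 0 \<and> (d \<le> i \<or> d \<le> j \<or> b \<le> i \<and> d - b \<le> j))
     :: 'k::field mpoly set)" (is "_ \<subseteq> mspan ?Q")
proof
  fix f :: "'k mpoly" assume "f \<in> idealI d b"
  then show "f \<in> mspan ?Q" unfolding idealI_def
  proof induction
    case zero then show ?case by (simp add: mspan_zero)
  next
    case (step a s j)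
    have "s \<in> mspan ?Q" using step
      by (auto simp: Var_monom monom_power monom_mult intro: mspan_monom)
    moreover have "a \<in> mspan (\<lambda>i j n. n = 0)" using step polyR_subset by blast
    ultimately have "a * s \<in> mspan ?Q"
      by (intro mspan_mult[of "\<lambda>i j n. n = 0" ?Q ?Q a s]) auto
    then show ?case using step by (simp add: mspan_add)
  qed
qed

lemma idealI_Tv_subset:
  assumes "(f :: 'k::field mpoly) \<in> idealI d b"
  shows "f * Tv \<in> mspan (\<lambda>i j n. rees_exp d b i j n \<and> n = 1)"
proof -
  have "f \<in> mspan (\<lambda>i j n. n = 0 \<and> (d \<le> i \<or> d \<le> j \<or> b \<le> i \<and> d - b \<le> j))"
    using assms idealI_subset by blast
  moreover have "Tv \<in> (mspan (\<lambda>i j n. i = 0 \<and> j = 0 \<and> n = 1) :: 'k mpoly set)"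
    by (simp add: Var_monom mspan_monom)
  ultimately show ?thesis
  proof (rule mspan_mult[rotated])
    fix i j n i' j' n' :: nat
    assume *: "n = 0 \<and> (d \<le> i \<or> d \<le> j \<or> b \<le> i \<and> d - b \<le> j)" "i' = 0 \<and> j' = 0 \<and> n' = 1"
    have "rees_exp d b i j 1"
      using * rees_exp_add[OF rees_exp_gens(1) rees_exp_zero, of d b "i - d" j]
        rees_exp_add[OF rees_exp_gens(2) rees_exp_zero, of d b i "j - d"]
        rees_exp_add[OF rees_exp_gens(3) rees_exp_zero, of d b "i - b" "j - (d - b)"]
      by auto
    with * show "rees_exp d b (i + i') (j + j') (n + n') \<and> n + n' = 1" by simp
  qed
qed

lemma idealI_gens:
  shows "(Xv ^ d :: 'k::field mpoly) \<in> idealI d b" "(Yv ^ d :: 'k::field mpoly) \<in> idealI d b"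
    "(Xv ^ b * Yv ^ (d - b) :: 'k::field mpoly) \<in> idealI d b"
proof -
  have 1: "1 \<in> (polyR :: 'k mpoly set)"
    unfolding polyR_def using k_alg.const[of 1] by (simp add: Const_def)
  have "s \<in> idealI d b" if "s \<in> {Xv ^ d, Yv ^ d, Xv ^ b * Yv ^ (d - b)}" for s :: "'k mpoly"
    unfolding idealI_def using ideal_gen.step[OF 1 that ideal_gen.zero] by simp
  then show "(Xv ^ d :: 'k::field mpoly) \<in> idealI d b" "(Yv ^ d :: 'k::field mpoly) \<in> idealI d b"
    "(Xv ^ b * Yv ^ (d - b) :: 'k::field mpoly) \<in> idealI d b" by blast+
qed

lemma idealI_Tv_gens:
  shows "\<exists>f. (monom d 0 1 :: 'k::field mpoly) = f * Tv \<and> f \<in> idealI d b"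
    "\<exists>f. (monom 0 d 1 :: 'k::field mpoly) = f * Tv \<and> f \<in> idealI d b"
    "\<exists>f. (monom b (d - b) 1 :: 'k::field mpoly) = f * Tv \<and> f \<in> idealI d b"
proof -
  show "\<exists>f. (monom d 0 1 :: 'k::field mpoly) = f * Tv \<and> f \<in> idealI d b"
    using idealI_gens(1)[of d b]
    by (intro exI[of _ "Xv ^ d"]) (simp add: Var_monom monom_power monom_mult)
  show "\<exists>f. (monom 0 d 1 :: 'k::field mpoly) = f * Tv \<and> f \<in> idealI d b"
    using idealI_gens(2)[of d b]
    by (intro exI[of _ "Yv ^ d"]) (simp add: Var_monom monom_power monom_mult)
  show "\<exists>f. (monom b (d - b) 1 :: 'k::field mpoly) = f * Tv \<and> f \<in> idealI d b"
    using idealI_gens(3)[of b d]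
    by (intro exI[of _ "Xv ^ b * Yv ^ (d - b)"]) (simp add: Var_monom monom_power monom_mult)
qed

text \<open>The algebra generators lie in the span, which is closed under products. Conversely, a
  monomial of the span is a product of the three monomial generators of degree one in
  \<open>t\<close>, with the surplus exponents taken up by \<open>x\<close> and
  \<open>y\<close>.\<close>

theorem rees_eq_mspan: "rees d b = (mspan (rees_exp d b) :: 'k::field mpoly set)"
proof (intro equalityI subsetI)
  fix f :: "'k mpoly" assume "f \<in> rees d b"
  then show "f \<in> mspan (rees_exp d b)" unfolding rees_def
  proof induction
    case (const c) then show ?case by (simp add: Const_mspan)
  next
    case (gen g)
    then consider "g = monom 1 0 0" | "g = monom 0 1 0" | f where "g = f * Tv" "f \<in> idealI d b"
      by (auto simp: Var_monom)
    then show ?case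
    proof cases
      case 3
      then show ?thesis using idealI_Tv_subset mspan_weaken by blast
    qed (simp_all add: mspan_monom)
  next
    case (add f g) then show ?case by (simp add: mspan_add)
  next
    case (mult f g) then show ?case by (auto intro: mspan_mult[rotated] rees_exp_add)
  qed
next
  let ?G = "{Xv, Yv} \<union> {f * Tv | f. f \<in> idealI d b} :: 'k mpoly set"
  fix f :: "'k mpoly" assume "f \<in> mspan (rees_exp d b)"
  then show "f \<in> rees d b" unfolding rees_def
  proof (induction rule: mspan_induct)
    case zero
    show ?case using k_alg.const[of 0 ?G] by (simp add: Const_def)
  next
    case (add p q)
    then show ?case by (rule k_alg.add)
  next
    case (monom c i j n)
    then obtain p q r where n: "p + q + r = n" and i: "d * p + b * r \<le> i"
      and j: "d * q + (d - b) * r \<le> j" unfolding rees_exp_def by blast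
    have "(monom i j n :: 'k mpoly) = monom 1 0 0 ^ (i - (d * p + b * r)) *
       monom 0 1 0 ^ (j - (d * q + (d - b) * r)) *
       (monom d 0 1 ^ p * monom 0 d 1 ^ q * monom b (d - b) 1 ^ r)"
      using n i j by (simp add: monom_power monom_mult algebra_simps)
    moreover have "monom 1 0 0 \<in> k_alg ?G" "monom 0 1 0 \<in> k_alg ?G"
      "monom d 0 1 \<in> k_alg ?G" "monom 0 d 1 \<in> k_alg ?G" "monom b (d - b) 1 \<in> k_alg ?G"
      using idealI_Tv_gens[where 'k='k] by (auto intro!: k_alg.gen simp: Var_monom)
    ultimately show ?case
      by (auto intro!: k_alg.mult k_alg.const k_alg_power)
  qed
qed

section \<open>The maximal homogeneous ideal\<close>

lemma mspan_nonzero_absorb: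
  assumes "p \<in> mspan (rees_exp d b)"
    and "q \<in> mspan (rees_exp_pos d b)"
  shows "p * q \<in> mspan (rees_exp_pos d b)"
  using _ assms by (rule mspan_mult) (auto simp: rees_exp_add rees_exp_pos_def)

text \<open>Generators without constant term generate an ideal without constant terms, which is how
  \<open>1\<close> is kept out of the ideals of regular sequences.\<close>

lemma ideal_gen_subset_nonzero:
  assumes "F \<subseteq> mspan (rees_exp_pos d b)"
  shows "ideal_gen (mspan (rees_exp d b)) F
    \<subseteq> mspan (rees_exp_pos d b)"
proof
  fix f assume "f \<in> ideal_gen (mspan (rees_exp d b)) F"
  then show "f \<in> mspan (rees_exp_pos d b)"
    by induction (use assms in \<open>auto simp: mspan_zero intro!: mspan_add mspan_nonzero_absorb\<close>)
qed

lemma rees_max_subset: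
  "rees_max d b \<subseteq> (mspan (rees_exp_pos d b)
     :: 'k::field mpoly set)"
  unfolding rees_max_def rees_eq_mspan
proof (rule ideal_gen_subset_nonzero, rule Un_least)
  show "{Xv, Yv} \<subseteq> (mspan (rees_exp_pos d b)
     :: 'k::field mpoly set)" by (simp add: Var_monom mspan_monom rees_exp_pos_def)
  show "{f * Tv | f. f \<in> idealI d b} \<subseteq> (mspan (rees_exp_pos d b) :: 'k::field mpoly set)"
    using idealI_Tv_subset by (fastforce simp: rees_exp_pos_def elim: mspan_weaken)
qed

lemma one_notin_nonzero:
  "(1 :: 'k::field mpoly) \<notin> mspan (rees_exp_pos d b)"
proof
  assume "(1 :: 'k mpoly) \<in> mspan (rees_exp_pos d b)"
  from mspan_mcoeff[OF this, of 0 0 0] show False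
    by (simp add: mcoeff_monom rees_exp_pos_def flip: monom_zero)
qed

lemma one_rees: "1 \<in> mspan (rees_exp d b)"
  by (simp add: mspan_monom flip: monom_zero)

lemma rees_max_add: "p \<in> rees_max d b \<Longrightarrow> q \<in> rees_max d b \<Longrightarrow> p + q \<in> rees_max d b"
  unfolding rees_max_def
  by (induction rule: ideal_gen.induct) (auto simp: add.assoc intro: ideal_gen.step)

lemma rees_max_gens:
  "(monom 1 0 0 :: 'k::field mpoly) \<in> rees_max d b"
  "(monom 0 1 0 :: 'k::field mpoly) \<in> rees_max d b"
  "(monom d 0 1 :: 'k::field mpoly) \<in> rees_max d b"
  "(monom 0 d 1 :: 'k::field mpoly) \<in> rees_max d b"
proof -
  have "s \<in> rees_max d b" if "s \<in> {Xv, Yv} \<union> {f * Tv | f. f \<in> idealI d b}" for s :: "'k mpoly"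
    unfolding rees_max_def rees_eq_mspan
    using ideal_gen.step[OF one_rees that ideal_gen.zero] by simp
  then show "(monom 1 0 0 :: 'k::field mpoly) \<in> rees_max d b"
  "(monom 0 1 0 :: 'k::field mpoly) \<in> rees_max d b"
  "(monom d 0 1 :: 'k::field mpoly) \<in> rees_max d b"
  "(monom 0 d 1 :: 'k::field mpoly) \<in> rees_max d b"
    using idealI_Tv_gens[where 'k='k] by (auto simp: Var_monom)
qed

section \<open>Regular sequences\<close>

locale k_subalgebra =
  fixes A :: "'k::field mpoly set"
  assumes Const_closed: "Const c \<in> A"
    and add_closed: "a \<in> A \<Longrightarrow> a' \<in> A \<Longrightarrow> a + a' \<in> A"
    and mult_closed: "a \<in> A \<Longrightarrow> a' \<in> A \<Longrightarrow> a * a' \<in> A"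
begin

lemma zero_closed: "0 \<in> A"
  using Const_closed[of 0] by (simp add: Const_def)

lemma one_closed: "1 \<in> A"
  using Const_closed[of 1] by (simp add: Const_def)

lemma uminus_closed: "a \<in> A \<Longrightarrow> - a \<in> A"
proof -
  assume "a \<in> A"
  then have "Const (- 1) * a \<in> A" by (intro mult_closed Const_closed)
  moreover have "(Const (- 1) :: 'k mpoly) = - 1" by (simp add: Const_def single_uminus)
  ultimately show "- a \<in> A" by simp
qed

lemma diff_closed: "a \<in> A \<Longrightarrow> a' \<in> A \<Longrightarrow> a - a' \<in> A"
  using add_closed[of a "- a'"] uminus_closed by simp

lemma power_closed: "a \<in> A \<Longrightarrow> a ^ m \<in> A"
  by (induction m) (auto simp: one_closed mult_closed)

lemma sum_closed: "(\<And>i. i \<in> I \<Longrightarrow> f i \<in> A) \<Longrightarrow> sum f I \<in> A"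
  by (induction I rule: infinite_finite_induct) (auto simp: zero_closed add_closed)

lemma ideal_gen_add:
  "p \<in> ideal_gen A F \<Longrightarrow> q \<in> ideal_gen A F \<Longrightarrow> p + q \<in> ideal_gen A F"
  by (induction rule: ideal_gen.induct) (auto simp: add.assoc intro: ideal_gen.step)

lemma ideal_gen_mult: "a \<in> A \<Longrightarrow> p \<in> ideal_gen A F \<Longrightarrow> a * p \<in> ideal_gen A F"
proof (rotate_tac, induction rule: ideal_gen.induct)
  case (step c s j)
  then have "(a * c) * s + a * j \<in> ideal_gen A F" by (intro ideal_gen.step mult_closed)
  then show ?case by (simp add: algebra_simps)
qed (simp add: ideal_gen.zero)

lemma ideal_gen_gen: "s \<in> F \<Longrightarrow> s \<in> ideal_gen A F"
  using ideal_gen.step[OF one_closed _ ideal_gen.zero] by simp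

lemma ideal_gen_empty: "ideal_gen A {} = {0}"
  by (auto intro: ideal_gen.zero elim: ideal_gen.cases)

lemma ideal_gen_single: "ideal_gen A {s} = {s * a | a. a \<in> A}"
proof (intro equalityI subsetI)
  fix p assume "p \<in> ideal_gen A {s}"
  then show "p \<in> {s * a | a. a \<in> A}"
  proof induction
    case zero
    show ?case using zero_closed by force
  next
    case (step a s' j)
    then obtain a' where "a' \<in> A" "j = s * a'" by blast
    with step show ?case
      by (intro CollectI exI[of _ "a + a'"]) (auto simp: add_closed algebra_simps)
  qed
next
  fix p assume "p \<in> {s * a | a. a \<in> A}"
  then show "p \<in> ideal_gen A {s}"
    using ideal_gen_mult[OF _ ideal_gen_gen[of s "{s}"]] by (auto simp: mult.commute)
qed

lemma ideal_gen_double: "ideal_gen A {s, t} = {s * a + t * c | a c. a \<in> A \<and> c \<in> A}"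
proof (intro equalityI subsetI)
  fix p assume "p \<in> ideal_gen A {s, t}"
  then show "p \<in> {s * a + t * c | a c. a \<in> A \<and> c \<in> A}"
  proof induction
    case zero
    show ?case using zero_closed by force
  next
    case (step e s' j)
    then obtain a c where ac: "a \<in> A" "c \<in> A" "j = s * a + t * c" by blast
    consider "s' = s" | "s' = t" using step by blast
    then show ?case
    proof cases
      case 1
      with step ac show ?thesis
        by (intro CollectI exI[of _ "e + a"] exI[of _ c]) (auto simp: add_closed algebra_simps)
    next
      case 2
      with step ac show ?thesis
        by (intro CollectI exI[of _ a] exI[of _ "e + c"]) (auto simp: add_closed algebra_simps)
    qed
  qed
next
  fix p assume "p \<in> {s * a + t * c | a c. a \<in> A \<and> c \<in> A}"
  then show "p \<in> ideal_gen A {s, t}"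
    using ideal_gen_mult[OF _ ideal_gen_gen[of s "{s, t}"]]
      ideal_gen_mult[OF _ ideal_gen_gen[of t "{s, t}"]]
    by (auto simp: mult.commute intro!: ideal_gen_add)
qed

lemma ideal_gen_mono: "F \<subseteq> F' \<Longrightarrow> p \<in> ideal_gen A F \<Longrightarrow> p \<in> ideal_gen A F'"
  by (rotate_tac, induction rule: ideal_gen.induct) (auto intro: ideal_gen.intros)

text \<open>Read \<open>a / \<alpha>\<close> and \<open>q / x\<close> as elements of the localisations
  \<open>U = \<alpha>\<inverse>A\<close> and \<open>V = \<beta>\<inverse>A \<inter> x\<inverse>A\<close>, whose intersection is \<open>A\<close> by
  \<open>detect\<close>. The class of \<open>\<mu> / (\<alpha>x)\<close> modulo \<open>U + V\<close> lives in the second local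
  cohomology, and an element annihilated by a regular sequence of length three vanishes there.\<close>
lemma split_of_regular_triple:
  assumes A: "x \<in> A" "\<alpha> \<in> A" "\<beta> \<in> A" "g1 \<in> A" "g2 \<in> A" "g3 \<in> A"
    and nz: "x \<noteq> 0" "g1 \<noteq> 0"
    and detect: "\<And>q a q'. q \<in> A \<Longrightarrow> a \<in> A \<Longrightarrow> q' \<in> A \<Longrightarrow> \<alpha> * q = x * a \<Longrightarrow> \<beta> * q = x * q'
      \<Longrightarrow> \<exists>r \<in> A. q = x * r"
    and reg2: "\<And>a c. a \<in> A \<Longrightarrow> c \<in> A \<Longrightarrow> g2 * a = g1 * c \<Longrightarrow> \<exists>e \<in> A. a = g1 * e"
    and reg3: "\<And>a c e. a \<in> A \<Longrightarrow> c \<in> A \<Longrightarrow> e \<in> A \<Longrightarrow> g3 * a = g1 * c + g2 * e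
      \<Longrightarrow> \<exists>c' \<in> A. \<exists>e' \<in> A. a = g1 * c' + g2 * e'"
    and split: "\<And>g. g \<in> {g1, g2, g3} \<Longrightarrow>
      \<exists>a \<in> A. \<exists>q \<in> A. \<exists>q' \<in> A. g * \<mu> = x * a + \<alpha> * q \<and> \<beta> * q = x * q'"
  shows "\<exists>a \<in> A. \<exists>q \<in> A. \<exists>q' \<in> A. \<mu> = x * a + \<alpha> * q \<and> \<beta> * q = x * q'"
proof -
  note closed = A add_closed mult_closed diff_closed uminus_closed
  obtain a1 q1 q1' where 1: "a1 \<in> A" "q1 \<in> A" "q1' \<in> A" "g1 * \<mu> = x * a1 + \<alpha> * q1" "\<beta> * q1 = x * q1'"
    using split[of g1] by blast
  obtain a2 q2 q2' where 2: "a2 \<in> A" "q2 \<in> A" "q2' \<in> A" "g2 * \<mu> = x * a2 + \<alpha> * q2" "\<beta> * q2 = x * q2'"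
    using split[of g2] by blast
  obtain a3 q3 q3' where 3: "a3 \<in> A" "q3 \<in> A" "q3' \<in> A" "g3 * \<mu> = x * a3 + \<alpha> * q3" "\<beta> * q3 = x * q3'"
    using split[of g3] by blast
  \<comment> \<open>Both splittings, multiplied crosswise, represent the same fraction. Their
    difference lies in \<open>U\<close> and in \<open>V\<close>, hence in \<open>A\<close>.\<close>
  have r: "\<exists>r \<in> A. g * q' - g' * q = x * r"
    if "g \<in> A" "g' \<in> A" "a \<in> A" "q \<in> A" "v \<in> A" "g * \<mu> = x * a + \<alpha> * q" "\<beta> * q = x * v"
      "a' \<in> A" "q' \<in> A" "v' \<in> A" "g' * \<mu> = x * a' + \<alpha> * q'" "\<beta> * q' = x * v'"
    for g g' a q v a' q' v'
  proof (rule detect)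
    have "g' * (x * a + \<alpha> * q) = g * (x * a' + \<alpha> * q')"
      unfolding that(6)[symmetric] that(11)[symmetric] by (simp add: ac_simps)
    then show "\<alpha> * (g * q' - g' * q) = x * (g' * a - g * a')" by algebra
    show "\<beta> * (g * q' - g' * q) = x * (g * v' - g' * v)"
      using that(7,12) by algebra
  qed (use that closed in simp_all)
  obtain r12 where r12: "r12 \<in> A" "g1 * q2 - g2 * q1 = x * r12"
    using r[OF A(4,5) 1 2] by blast
  obtain r13 where r13: "r13 \<in> A" "g1 * q3 - g3 * q1 = x * r13"
    using r[OF A(4,6) 1 3] by blast
  obtain r23 where r23: "r23 \<in> A" "g2 * q3 - g3 * q2 = x * r23"
    using r[OF A(5,6) 2 3] by blast
  \<comment> \<open>The remainders satisfy the Koszul relation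
    \<open>g1 r23 - g2 r13 + g3 r12 = 0\<close>. Regularity of \<open>g3\<close> modulo
    \<open>g1\<close>, \<open>g2\<close> then decomposes \<open>r12\<close>.\<close>
  have "x * (g3 * r12) = x * (g1 * (- r23) + g2 * r13)"
    using r12 r13 r23 by algebra
  then have "g3 * r12 = g1 * (- r23) + g2 * r13" using nz by simp
  then obtain s2 s1 where s: "s2 \<in> A" "s1 \<in> A" "r12 = g1 * s2 + g2 * s1"
    using reg3 r12 r13 r23 closed by metis
  \<comment> \<open>Correcting the first splitting by \<open>s1\<close> and the second by
    \<open>s2\<close> makes them proportional, so regularity of \<open>g2\<close> modulo
    \<open>g1\<close> extracts a factor \<open>g1\<close> from the corrected \<open>q1\<close>,
    \<open>a1\<close> and \<open>q1'\<close> in turn.\<close>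
  have "g2 * (q1 + x * s1) = g1 * (q2 - x * s2)"
    using r12 s by algebra
  then obtain q where q: "q \<in> A" "q1 + x * s1 = g1 * q"
    using reg2 1 2 s closed by metis
  have "x * (g2 * (a1 - \<alpha> * s1)) = x * (g1 * (a2 + \<alpha> * s2))"
    using r12 s 1(4) 2(4) by algebra
  then have "g2 * (a1 - \<alpha> * s1) = g1 * (a2 + \<alpha> * s2)" using nz by simp
  then obtain a where a: "a \<in> A" "a1 - \<alpha> * s1 = g1 * a"
    using reg2 1 2 s closed by metis
  have "x * (g2 * (q1' + \<beta> * s1)) = x * (g1 * (q2' - \<beta> * s2))"
    using r12 s 1(5) 2(5) by algebra
  then have "g2 * (q1' + \<beta> * s1) = g1 * (q2' - \<beta> * s2)" using nz by simp
  then obtain q' where q': "q' \<in> A" "q1' + \<beta> * s1 = g1 * q'"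
    using reg2 1 2 s closed by metis
  have "g1 * \<mu> = g1 * (x * a + \<alpha> * q)" using 1(4) a(2) q(2) by algebra
  moreover have "g1 * (\<beta> * q) = g1 * (x * q')" using 1(5) q(2) q'(2) by algebra
  ultimately show ?thesis using a(1) q(1) q'(1) nz by auto
qed

end

section \<open>Divisibility by \<open>x\<close> and regular sequences in the Rees algebra\<close>

lemma rees_subalgebra: "k_subalgebra (mspan (rees_exp d b) :: 'k::field mpoly set)"
  by unfold_locales (auto simp: Const_mspan mspan_add rees_exp_add intro: mspan_mult[rotated])

lemma mcoeff_rees_half:
  assumes "b \<le> d" "a \<in> mspan (rees_exp d b)" "mcoeff a i j n \<noteq> 0"
  shows "half_exp d b i j n" "half_exp d (d - b) j i n"
  using mspan_mcoeff[OF assms(2,3)] assms(1) by (simp_all add: rees_exp_iff_half_exp)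

text \<open>This supplies \<open>detect\<close> in \<open>split_of_regular_triple\<close>. At a
  monomial of \<open>q\<close>, the \<open>y^d t\<close> equation yields the first half condition
  for the quotient by \<open>x\<close> and the \<open>x^d t\<close> equation the second, by
  \<open>half_exp_shift\<close>.\<close>

lemma rees_detect:
  assumes "b \<le> d" "d > 0"
    and A: "q \<in> mspan (rees_exp d b)" "a \<in> mspan (rees_exp d b)" "q' \<in> mspan (rees_exp d b)"
    and eq: "monom d 0 1 * q = monom 1 0 0 * a" "monom 0 d 1 * q = monom 1 0 0 * q'"
  shows "\<exists>r \<in> mspan (rees_exp d b). q = monom 1 0 0 * r"
  using A(1)
proof (rule mspan_divide)
  fix i j n assume nz: "mcoeff q i j n \<noteq> 0"
  from arg_cong[OF eq(2), of "\<lambda>p. mcoeff p i (j + d) (Suc n)"] nz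
  have i: "1 \<le> i" "mcoeff q' (i - 1) (j + d) (Suc n) \<noteq> 0"
    by (auto simp: mcoeff_monom_mult split: if_splits)
  from arg_cong[OF eq(1), of "\<lambda>p. mcoeff p (i + d) j (Suc n)"] nz i assms(2)
  have "mcoeff a ((i - 1) + d) j (Suc n) \<noteq> 0"
    by (auto simp: mcoeff_monom_mult split: if_splits)
  then have "half_exp d b (i - 1) j n" "half_exp d (d - b) j (i - 1) n"
    using i(2) mcoeff_rees_half[OF assms(1) A(3)] mcoeff_rees_half[OF assms(1) A(2)]
    unfolding half_exp_shift[symmetric, where n = n] by blast+
  then show "1 \<le> i \<and> 0 \<le> j \<and> 0 \<le> n \<and> rees_exp d b (i - 1) (j - 0) (n - 0)"
    using i assms(1) by (simp add: rees_exp_iff_half_exp)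
qed

text \<open>The two half conditions for the quotient by \<open>x\<close> are proved separately, by
  induction on \<open>i\<close> and on \<open>j\<close>. Where one fails, the right side has no
  corresponding coefficient, so another monomial of \<open>a\<close> must cancel the given one, and
  \<open>half_exp_transfer\<close> carries the condition back from there.\<close>

lemma rees_regular_pair:
  fixes a :: "'k::field mpoly"
  assumes "b \<le> d" "d > 0"
    and A: "a \<in> mspan (rees_exp d b)" "c \<in> mspan (rees_exp d b)"
    and eq: "(monom d 0 1 + monom 0 d 1) * a = monom 1 0 0 * c"
  shows "\<exists>r \<in> mspan (rees_exp d b). a = monom 1 0 0 * r"
proof -
  note coeff_simps = mcoeff_add distrib_right mcoeff_monom_mult
  have x: "1 \<le> i \<and> half_exp d b (i - 1) j n" if "mcoeff a i j n \<noteq> 0" for i j n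
    using that
  proof (induction i arbitrary: j rule: less_induct)
    case (less i)
    show ?case
    proof (rule ccontr)
      assume neg: "\<not> ?case"
      have "mcoeff (monom 1 0 0 * c) i (j + d) (Suc n) = 0"
      proof (rule ccontr)
        assume "mcoeff (monom 1 0 0 * c) i (j + d) (Suc n) \<noteq> 0"
        then have "1 \<le> i" "mcoeff c (i - 1) (j + d) (Suc n) \<noteq> 0"
          by (auto simp: mcoeff_monom_mult split: if_splits)
        with neg mcoeff_rees_half[OF assms(1) A(2)] show False
          unfolding half_exp_shift[symmetric, where n = n] by blast
      qed
      \<comment> \<open>Two terms of the left side contribute at \<open>(i, j + d, n + 1)\<close>.
        Their sum is zero, so the one coming from \<open>x^d t\<close> is nonzero and the induction
        descends to \<open>i - d\<close>.\<close>
      then have "(if d \<le> i then mcoeff a (i - d) (j + d) n else 0) + mcoeff a i j n = 0"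
        unfolding eq[symmetric] by (simp add: coeff_simps cong: if_cong)
      with less.prems have "d \<le> i" "mcoeff a (i - d) (j + d) n \<noteq> 0"
        by (auto split: if_splits)
      with less.IH[of "i - d"] \<open>d > 0\<close>
      have "1 \<le> i - d" "half_exp d b (i - d - 1) (j + d) n" by auto
      with half_exp_transfer[of d b "i - d - 1" j n] neg show False by simp
    qed
  qed
  have y: "half_exp d (d - b) j (i - 1) n" if "mcoeff a i j n \<noteq> 0" for i j n
    using that
  proof (induction j arbitrary: i rule: less_induct)
    case (less j)
    have i: "1 \<le> i" using x less.prems by blast
    show ?case
    proof (rule ccontr)
      assume neg: "\<not> ?case"
      have "mcoeff (monom 1 0 0 * c) (i + d) j (Suc n) = 0"
      proof (rule ccontr)
        assume "mcoeff (monom 1 0 0 * c) (i + d) j (Suc n) \<noteq> 0"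
        then have "mcoeff c ((i - 1) + d) j (Suc n) \<noteq> 0"
          using i by (auto simp: mcoeff_monom_mult split: if_splits)
        with neg mcoeff_rees_half[OF assms(1) A(2)] show False
          unfolding half_exp_shift[symmetric, where n = n] by blast
      qed
      then have "mcoeff a i j n + (if d \<le> j then mcoeff a (i + d) (j - d) n else 0) = 0"
        unfolding eq[symmetric] by (simp add: coeff_simps cong: if_cong)
      with less.prems have "d \<le> j" "mcoeff a (i + d) (j - d) n \<noteq> 0"
        by (auto split: if_splits)
      with less.IH[of "j - d"] \<open>d > 0\<close> i
      have "half_exp d (d - b) (j - d) ((i - 1) + d) n" by auto
      with half_exp_transfer[of d "d - b" "j - d" "i - 1" n] \<open>d \<le> j\<close> neg show False by simp
    qed
  qed
  show ?thesis
    using A(1) by (rule mspan_divide) (use x y assms(1) in \<open>auto simp: rees_exp_iff_half_exp\<close>)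
qed

lemma regular_seq_rees_pair:
  assumes "b \<le> d" "d > 0"
  shows "regular_seq (rees d b :: 'k::field mpoly set) (rees_max d b)
    [monom 1 0 0, monom d 0 1 + monom 0 d 1]" (is "regular_seq _ _ [?x, ?s]")
proof -
  interpret k_subalgebra "mspan (rees_exp d b) :: 'k mpoly set" by (rule rees_subalgebra)
  have M: "{?x, ?s} \<subseteq> rees_max d b" using rees_max_gens[where 'k='k] rees_max_add by blast
  have "1 \<notin> ideal_gen (mspan (rees_exp d b)) {?x, ?s}"
    using ideal_gen_subset_nonzero[of "{?x, ?s}" d b] M rees_max_subset[where 'k='k]
      one_notin_nonzero by blast
  moreover have "a \<in> ideal_gen (mspan (rees_exp d b)) {?x}"
    if "a \<in> mspan (rees_exp d b)" "?s * a \<in> ideal_gen (mspan (rees_exp d b)) {?x}" for a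
    using that rees_regular_pair[OF assms] unfolding ideal_gen_single by blast
  ultimately show ?thesis
    unfolding regular_seq_def rees_eq_mspan using M
    by (auto simp: less_Suc_eq ideal_gen_empty monom_neq_0)
qed

text \<open>For \<open>d = 2\<close> the ideal is the square of \<open>(x, y)\<close>. Both
  semigroups contain \<open>1\<close>, so only the total degree matters.\<close>

lemma rees_exp_2_1: "rees_exp 2 1 i j n \<longleftrightarrow> 2 * n \<le> i + j"
proof
  assume "2 * n \<le> i + j"
  then have "half_exp 2 1 i j n" "half_exp 2 1 j i n"
    unfolding half_exp_def by (rule_tac exI[of _ 0], rule_tac exI[of _ i], simp)
      (rule_tac exI[of _ 0], rule_tac exI[of _ j], use \<open>2 * n \<le> i + j\<close> in simp)
  then show "rees_exp 2 1 i j n" by (simp add: rees_exp_iff_half_exp)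
qed (auto simp: rees_exp_def)

text \<open>Modulo \<open>x\<close> and \<open>y^2 t\<close> only powers of \<open>y\<close> and
  monomials with \<open>n > 0\<close>, \<open>j \<le> 1\<close>, \<open>i + j = 2n\<close> can
  survive. For the third element the former are tracked through \<open>y\<close> and the latter
  through \<open>x^2 t\<close>.\<close>

lemma regular_seq_rees_triple:
  "regular_seq (rees 2 1 :: 'k::field mpoly set) (rees_max 2 1)
    [monom 1 0 0, monom 0 2 1, monom 0 1 0 + monom 2 0 1]" (is "regular_seq _ _ [?x, ?y, ?s]")
proof -
  let ?A = "mspan (rees_exp 2 1) :: 'k mpoly set"
  interpret k_subalgebra ?A by (rule rees_subalgebra)
  have M: "{?x, ?y, ?s} \<subseteq> rees_max 2 1" using rees_max_gens[where 'k='k] rees_max_add by blast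
  have one: "1 \<notin> ideal_gen ?A {?x, ?y, ?s}"
    using ideal_gen_subset_nonzero[of "{?x, ?y, ?s}" 2 1] M rees_max_subset[where 'k='k]
      one_notin_nonzero by blast
  have reg1: "a \<in> ideal_gen ?A {}" if "?x * a \<in> ideal_gen ?A {}" for a
    using that unfolding ideal_gen_empty by (simp add: monom_neq_0)
  have reg2: "a \<in> ideal_gen ?A {?x}" if a: "a \<in> ?A" "?y * a \<in> ideal_gen ?A {?x}" for a
  proof -
    obtain c where c: "c \<in> ?A" "?y * a = ?x * c" using a unfolding ideal_gen_single by blast
    have "\<exists>r \<in> ?A. a = ?x * r"
      using a(1)
    proof (rule mspan_divide)
      fix i j n assume "mcoeff a i j n \<noteq> 0"
      with arg_cong[OF c(2), of "\<lambda>p. mcoeff p i (j + 2) (Suc n)"]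
      have "1 \<le> i" "mcoeff c (i - 1) (j + 2) (Suc n) \<noteq> 0"
        by (auto simp: mcoeff_monom_mult split: if_splits)
      moreover from mspan_mcoeff[OF c(1) this(2)] have "2 * Suc n \<le> i - 1 + (j + 2)"
        unfolding rees_exp_2_1 .
      ultimately show "1 \<le> i \<and> 0 \<le> j \<and> 0 \<le> n \<and> rees_exp 2 1 (i - 1) (j - 0) (n - 0)"
        unfolding rees_exp_2_1 by simp
    qed
    then show ?thesis unfolding ideal_gen_single by blast
  qed
  have reg3: "a \<in> ideal_gen ?A {?x, ?y}" if a: "a \<in> ?A" "?s * a \<in> ideal_gen ?A {?x, ?y}" for a
  proof -
    obtain c e where ce: "c \<in> ?A" "e \<in> ?A" and eq: "?s * a = ?x * c + ?y * e"
      using a unfolding ideal_gen_double by blast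
    note coeffs = arg_cong[OF eq, of "\<lambda>p. mcoeff p i j n" for i j n,
        unfolded mcoeff_add distrib_right mcoeff_monom_mult]
    have bound: "2 * n \<le> i + j" if "mcoeff f i j n \<noteq> 0" "f \<in> ?A" for f :: "'k mpoly" and i j n
      using mspan_mcoeff[OF that(2,1)] unfolding rees_exp_2_1 .
    have "1 \<le> i \<and> 2 * n \<le> i - 1 + j \<or> 2 \<le> j \<and> 1 \<le> n" if nz: "mcoeff a i j n \<noteq> 0" for i j n
    proof (rule ccontr)
      assume neg: "\<not> ?thesis"
      have b: "2 * n \<le> i + j" using bound[OF nz a(1)] .
      show False
      proof (cases "n = 0")
        case True
        with neg have "i = 0" by auto
        \<comment> \<open>At \<open>y^(j+1)\<close> only the product of \<open>y\<close> with
          \<open>y^j\<close> contributes.\<close>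
        with True nz coeffs[of 0 "Suc j" 0] show False by simp
      next
        case False
        with neg b have ij: "j \<le> 1" "i + j = 2 * n" by auto
        \<comment> \<open>At \<open>x^(i+2) y^j t^(n+1)\<close> the degree bound excludes
          contributions of \<open>y a\<close> and \<open>x c\<close>, and \<open>j \<le> 1\<close>
          excludes that of \<open>y^2 t e\<close>.\<close>
        then have "mcoeff a (i + 2) (j - 1) (Suc n) = 0 \<or> j = 0"
          using bound[OF _ a(1), of "i + 2" "j - 1" "Suc n"] by (cases "j = 0") auto
        moreover have "mcoeff c (Suc i) j (Suc n) = 0"
          using bound[OF _ ce(1), of "Suc i" j "Suc n"] ij by auto
        ultimately show False using coeffs[of "i + 2" j "Suc n"] ij nz
          by (auto split: if_splits)
      qed
    qed
    then have "a \<in> mspan (\<lambda>i j n. (1 \<le> i \<and> 2 * n \<le> i - 1 + j) \<or>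
        (2 \<le> j \<and> 1 \<le> n \<and> 2 * n \<le> i + j))"
      using bound[OF _ a(1)] by (intro mspan_restrict[OF a(1)]) blast
    then obtain u v where u: "u \<in> mspan (\<lambda>i j n. 1 \<le> i \<and> 2 * n \<le> i - 1 + j)"
      and v: "v \<in> mspan (\<lambda>i j n. 2 \<le> j \<and> 1 \<le> n \<and> 2 * n \<le> i + j)" and "a = u + v"
      by (drule_tac mspan_split) blast
    moreover have "\<exists>r \<in> ?A. u = ?x * r"
      using u by (rule mspan_divide) (drule mspan_mcoeff[OF u], unfold rees_exp_2_1, linarith)
    moreover have "\<exists>r \<in> ?A. v = ?y * r"
      using v by (rule mspan_divide) (drule mspan_mcoeff[OF v], unfold rees_exp_2_1, linarith)
    ultimately show ?thesis unfolding ideal_gen_double by blast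
  qed
  have "a \<in> ideal_gen ?A (set (take i [?x, ?y, ?s]))"
    if "i < 3" "a \<in> ?A" "[?x, ?y, ?s] ! i * a \<in> ideal_gen ?A (set (take i [?x, ?y, ?s]))" for i a
  proof -
    from that(1) consider "i = 0" | "i = 1" | "i = 2" by linarith
    then show ?thesis
      using that(2,3) reg1[of a] reg2[of a] reg3[of a] by cases (simp_all add: numeral_2_eq_2)
  qed
  then show ?thesis
    unfolding regular_seq_def rees_eq_mspan using M one by simp
qed

section \<open>The socle of the second local cohomology, and a chain of primes\<close>

text \<open>With \<alpha> = \<open>x^d t\<close>, \<beta> = \<open>y^d t\<close> and \<mu> =
  \<open>x^d y^(d-b-1) t\<close>, the fraction of \<mu> by \<alpha> and \<open>x\<close> is
  \<open>y^(d-b-1) / x\<close>, and the maximal ideal annihilates its class. The \<open>g\<close>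
  admitting a splitting are closed under sums and multiples, so the generators suffice.\<close>

lemma rees_max_split:
  fixes g :: "'k::field mpoly"
  assumes d: "2 * b < d" "1 \<le> b" and g: "g \<in> rees_max d b"
  shows "\<exists>a \<in> mspan (rees_exp d b). \<exists>q \<in> mspan (rees_exp d b). \<exists>q' \<in> mspan (rees_exp d b).
     g * monom d (d - b - 1) 1 = monom 1 0 0 * a + monom d 0 1 * q
       \<and> monom 0 d 1 * q = monom 1 0 0 * q'"
proof -
  define A where "A = (mspan (rees_exp d b) :: 'k mpoly set)"
  interpret k_subalgebra A unfolding A_def by (rule rees_subalgebra)
  define S where "S g \<longleftrightarrow> (\<exists>a \<in> A. \<exists>q \<in> A. \<exists>q' \<in> A.
     g * monom d (d - b - 1) 1 = monom 1 0 0 * a + monom d 0 1 * q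
       \<and> monom 0 d 1 * q = monom 1 0 0 * q')" for g :: "'k mpoly"
  have S_add: "S (f + g)" if fg: "S f" "S g" for f g
  proof -
    obtain a q q' a' r r' where
      "a \<in> A" "q \<in> A" "q' \<in> A" "a' \<in> A" "r \<in> A" "r' \<in> A"
      "f * monom d (d - b - 1) 1 = monom 1 0 0 * a + monom d 0 1 * q"
      "monom 0 d 1 * q = monom 1 0 0 * q'"
      "g * monom d (d - b - 1) 1 = monom 1 0 0 * a' + monom d 0 1 * r"
      "monom 0 d 1 * r = monom 1 0 0 * r'"
      using fg unfolding S_def by blast
    then show ?thesis unfolding S_def
      by (intro bexI[of _ "a + a'"] bexI[of _ "q + r"] bexI[of _ "q' + r'"])
        (auto simp: distrib_left distrib_right add_closed)
  qed
  have S_mult: "S (h * f)" if hf: "h \<in> A" "S f" for h f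
  proof -
    obtain a q q' where *: "a \<in> A" "q \<in> A" "q' \<in> A"
      "f * monom d (d - b - 1) 1 = monom 1 0 0 * a + monom d 0 1 * q"
      "monom 0 d 1 * q = monom 1 0 0 * q'"
      using hf unfolding S_def by blast
    have "(h * f) * monom d (d - b - 1) 1 = monom 1 0 0 * (h * a) + monom d 0 1 * (h * q)"
      using *(4) by algebra
    moreover have "monom 0 d 1 * (h * q) = monom 1 0 0 * (h * q')"
      using *(5) by algebra
    ultimately show ?thesis unfolding S_def using * hf mult_closed by blast
  qed
  \<comment> \<open>Splittings with \<open>q = q' = 0\<close>.\<close>
  have S_left: "S (monom i j n)" if "rees_exp d b (i + d - 1) (j + (d - b - 1)) (n + 1)" for i j n
  proof -
    have "(monom i j n * monom d (d - b - 1) 1 :: 'k mpoly)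
        = monom 1 0 0 * monom (i + d - 1) (j + (d - b - 1)) (n + 1)"
      using d by (simp add: monom_mult)
    moreover have "monom (i + d - 1) (j + (d - b - 1)) (n + 1) \<in> A"
      using that unfolding A_def by (rule mspan_monom)
    ultimately show ?thesis unfolding S_def using zero_closed
      by (intro bexI[of _ "monom (i + d - 1) (j + (d - b - 1)) (n + 1)"] bexI[of _ 0]) simp_all
  qed
  \<comment> \<open>Two copies of \<open>x^b y^(d-b) t\<close> divide this monomial because
    \<open>2b < d\<close> and \<open>1 \<le> b\<close>.\<close>
  have *: "rees_exp d b (d - 1) (d + (d - b - 1)) 2"
    unfolding rees_exp_def
    by (rule exI[of _ 0], rule exI[of _ 0], rule exI[of _ 2]) (use d in linarith)
  have "S (monom 1 0 0)"
    by (rule S_left) (use rees_exp_add[OF rees_exp_gens(1) rees_exp_zero, of d b 0 "d - b - 1"] d in simp)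
  moreover have "S (monom 0 1 0)"
    by (rule S_left)
      (use rees_exp_add[OF rees_exp_gens(3) rees_exp_zero, of d b "d - b - 1" 0] d
        in \<open>simp add: Suc_diff_Suc\<close>)
  moreover have "S (monom 0 d 1)"
    by (rule S_left) (use * in \<open>simp add: numeral_2_eq_2\<close>)
  \<comment> \<open>Here the product of \<open>x^d t\<close> and \<open>y^d t\<close> divides the
    quotient by \<open>x\<close>. The \<open>y\<close>-exponent again requires
    \<open>2b < d\<close>.\<close>
  moreover have "S (monom b (d - b) 1)"
  proof (rule S_left)
    show "rees_exp d b (b + d - 1) (d - b + (d - b - 1)) (1 + 1)"
      unfolding rees_exp_def
      by (rule exI[of _ 1], rule exI[of _ 1], rule exI[of _ 0]) (simp, use d in arith)
  qed
  \<comment> \<open>The one generator with \<open>q\<close> nonzero: \<open>q\<close> is the socle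
    numerator \<mu> itself, and \<open>y^d t\<close> times \<mu> is divisible by
    \<open>x\<close>.\<close>
  moreover have "S (monom d 0 1)"
  proof -
    have "monom d (d - b - 1) 1 \<in> A" "monom (d - 1) (d + (d - b - 1)) 2 \<in> A"
      unfolding A_def using * rees_exp_add[OF rees_exp_gens(1) rees_exp_zero, of d b 0 "d - b - 1"]
      by (auto intro!: mspan_monom)
    moreover have "(monom 0 d 1 * monom d (d - b - 1) 1 :: 'k mpoly)
        = monom 1 0 0 * monom (d - 1) (d + (d - b - 1)) 2"
      using d by (simp add: monom_mult numeral_2_eq_2)
    ultimately show ?thesis unfolding S_def using zero_closed
      by (intro bexI[of _ 0] bexI[of _ "monom d (d - b - 1) 1"]
          bexI[of _ "monom (d - 1) (d + (d - b - 1)) 2"]) simp_all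
  qed
  ultimately have gens: "S (monom i j n * monom i' j' n')"
    if "rees_exp d b i j n" "(i', j', n') \<in> {(1,0,0),(0,1,0),(d,0,1),(0,d,1),(b,d-b,1)}"
    for i j n i' j' n'
    using that by (intro S_mult) (auto simp: A_def intro: mspan_monom)
  have monoms: "S (monom i j n)" if pos: "rees_exp_pos d b i j n" for i j n
  proof -
    from pos obtain p q r where n: "p + q + r = n" and i: "d * p + b * r \<le> i"
      and j: "d * q + (d - b) * r \<le> j" unfolding rees_exp_pos_def rees_exp_def by blast
    have exp: "rees_exp d b i' j' n'" if "\<exists>p q r. p + q + r = n' \<and> d * p + b * r \<le> i' \<and> d * q + (d - b) * r \<le> j'"
      for i' j' n' using that unfolding rees_exp_def .
    consider "n = 0" "i \<noteq> 0" | "n = 0" "j \<noteq> 0" | "p \<noteq> 0" | "q \<noteq> 0" | "r \<noteq> 0"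
      using pos n unfolding rees_exp_pos_def by fastforce
    then show ?thesis
    proof cases
      case 1
      then show ?thesis using gens[of "i - 1" j 0 1 0 0] by (simp add: monom_mult)
    next
      case 2
      then show ?thesis using gens[of i "j - 1" 0 0 1 0] by (simp add: monom_mult)
    next
      case 3
      then obtain p' where p': "p = Suc p'" using not0_implies_Suc by blast
      have "rees_exp d b (i - d) j (n - 1)"
        by (rule exp, rule exI[of _ p'], rule exI[of _ q], rule exI[of _ r]) (use p' n i j in auto)
      then show ?thesis using gens[of "i - d" j "n - 1" d 0 1] p' n i by (simp add: monom_mult)
    next
      case 4
      then obtain q' where q': "q = Suc q'" using not0_implies_Suc by blast
      have "rees_exp d b i (j - d) (n - 1)"
        by (rule exp, rule exI[of _ p], rule exI[of _ q'], rule exI[of _ r]) (use q' n i j in auto)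
      then show ?thesis using gens[of i "j - d" "n - 1" 0 d 1] q' n j by (simp add: monom_mult)
    next
      case 5
      then obtain r' where r': "r = Suc r'" using not0_implies_Suc by blast
      have "rees_exp d b (i - b) (j - (d - b)) (n - 1)"
        by (rule exp, rule exI[of _ p], rule exI[of _ q], rule exI[of _ r']) (use r' n i j in auto)
      then show ?thesis using gens[of "i - b" "j - (d - b)" "n - 1" b "d - b" 1] r' n i j
        by (simp add: monom_mult)
    qed
  qed
  have "g \<in> mspan (rees_exp_pos d b)" using g rees_max_subset by blast
  then have "S g"
  proof (induction rule: mspan_induct)
    case zero
    show ?case using S_mult[OF zero_closed \<open>S (monom 1 0 0)\<close>] by simp
  next
    case (add p q)
    then show ?case by (rule S_add)
  next
    case (monom c i j n)
    then show ?case by (intro S_mult monoms Const_closed)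
  qed
  then show ?thesis unfolding S_def A_def .
qed

text \<open>The socle class is nonzero, as coefficients at \<open>x^d y^(d-b-1) t\<close> show. A
  contribution of \<open>a\<close> would need \<open>x^(d-1) y^(d-b-1) t\<close>, which none of the
  three generators of degree one in \<open>t\<close> divides. One of \<open>q\<close> would need the
  term \<open>y^(d-b-1)\<close>, excluded because \<open>x\<close> divides
  \<open>y^d t q\<close>.\<close>

lemma rees_no_split_one:
  assumes d: "2 * b < d" "1 \<le> b"
    and a: "a \<in> mspan (rees_exp d b)"
    and eq: "(monom d (d - b - 1) 1 :: 'k::field mpoly) = monom 1 0 0 * a + monom d 0 1 * q"
      "monom 0 d 1 * q = monom 1 0 0 * q'"
  shows False
proof -
  have "mcoeff a (d - 1) (d - b - 1) 1 = 0"
  proof (rule ccontr)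
    assume "mcoeff a (d - 1) (d - b - 1) 1 \<noteq> 0"
    then have "rees_exp d b (d - 1) (d - b - 1) 1" by (rule mspan_mcoeff[OF a])
    then obtain p q r where *: "p + q + r = 1" "d * p + b * r \<le> d - 1"
      "d * q + (d - b) * r \<le> d - b - 1"
      unfolding rees_exp_def by blast
    then consider "p = 1" | "q = 1" | "r = 1" by linarith
    then show False using d * by cases simp_all
  qed
  moreover have "mcoeff q 0 (d - b - 1) 0 = 0"
    using arg_cong[OF eq(2), of "\<lambda>p. mcoeff p 0 (d + (d - b - 1)) 1"]
    by (simp add: mcoeff_monom_mult)
  ultimately show False
    using arg_cong[OF eq(1), of "\<lambda>p. mcoeff p d (d - b - 1) 1"] d
    by (simp add: mcoeff_monom_mult mcoeff_add mcoeff_monom)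
qed

text \<open>Three elements of a regular sequence would let \<open>split_of_regular_triple\<close>
  split the socle numerator itself, against \<open>rees_no_split_one\<close>.\<close>

lemma regular_seq_rees_length:
  assumes d: "2 * b < d" "1 \<le> b"
    and reg: "regular_seq (rees d b :: 'k::field mpoly set) (rees_max d b) fs"
  shows "length fs \<le> 2"
proof (rule ccontr)
  assume "\<not> length fs \<le> 2"
  then obtain g1 g2 g3 gs where fs: "fs = g1 # g2 # g3 # gs"
    by (cases fs; cases "tl fs"; cases "tl (tl fs)") auto
  let ?A = "mspan (rees_exp d b) :: 'k mpoly set"
  interpret k_subalgebra ?A by (rule rees_subalgebra)
  have M: "g1 \<in> rees_max d b" "g2 \<in> rees_max d b" "g3 \<in> rees_max d b"
    using reg unfolding regular_seq_def fs by auto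
  have "rees_max d b \<subseteq> ?A"
    using rees_max_subset mspan_weaken unfolding rees_exp_pos_def by blast
  with M have gA: "g1 \<in> ?A" "g2 \<in> ?A" "g3 \<in> ?A" by auto
  have step: "a \<in> ideal_gen ?A (set (take i fs))"
    if "i < length fs" "a \<in> ?A" "fs ! i * a \<in> ideal_gen ?A (set (take i fs))" for i a
    using reg that unfolding regular_seq_def rees_eq_mspan by blast
  have g1: "g1 \<noteq> 0"
    using step[of 0 1] one_closed unfolding fs by (auto simp: ideal_gen_empty)
  have g2: "\<exists>e \<in> ?A. a = g1 * e" if "a \<in> ?A" "c \<in> ?A" "g2 * a = g1 * c" for a c
    using step[of 1 a] that unfolding fs by (auto simp: ideal_gen_single)
  have g3: "\<exists>c' \<in> ?A. \<exists>e' \<in> ?A. a = g1 * c' + g2 * e'"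
    if "a \<in> ?A" "c \<in> ?A" "e \<in> ?A" "g3 * a = g1 * c + g2 * e" for a c e
    using step[of 2 a] that unfolding fs by (auto simp: ideal_gen_double)
  have x: "monom 1 0 0 \<in> ?A" "monom d 0 1 \<in> ?A" "monom 0 d 1 \<in> ?A"
    using rees_exp_gens by (auto intro!: mspan_monom)
  have "\<exists>a \<in> ?A. \<exists>q \<in> ?A. \<exists>q' \<in> ?A. monom d (d - b - 1) 1 = monom 1 0 0 * a + monom d 0 1 * q
      \<and> monom 0 d 1 * q = monom 1 0 0 * q'"
  proof (rule split_of_regular_triple[OF x gA monom_neq_0 g1 _ g2 g3])
    fix q a q' assume "q \<in> ?A" "a \<in> ?A" "q' \<in> ?A"
      "monom d 0 1 * q = monom 1 0 0 * a" "monom 0 d 1 * q = monom 1 0 0 * q'"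
    then show "\<exists>r \<in> ?A. q = monom 1 0 0 * r"
      using d by (intro rees_detect[of b d q a q']) linarith+
  next
    fix g assume "g \<in> {g1, g2, g3}"
    then have "g \<in> rees_max d b" using M by blast
    then show "\<exists>a \<in> ?A. \<exists>q \<in> ?A. \<exists>q' \<in> ?A. g * monom d (d - b - 1) 1 =
        monom 1 0 0 * a + monom d 0 1 * q \<and> monom 0 d 1 * q = monom 1 0 0 * q'"
      by (rule rees_max_split[OF d])
  qed
  with rees_no_split_one[OF d] show False by blast
qed

text \<open>The condition on \<open>Z\<close> says that the exponents off \<open>Z\<close> form a
  face of the monoid. Modulo \<open>?P\<close> two factors can be replaced by their parts off
  \<open>Z\<close>. If the product lies in \<open>?P\<close>, that of the parts is supported both on
  and off \<open>Z\<close>, so it is zero and one part vanishes.\<close>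

lemma prime_ideal_mspan:
  assumes Z: "\<And>i j n i' j' n'. Z (i + i') (j + j') (n + n') \<longleftrightarrow> Z i j n \<or> Z i' j' n'"
    and Z0: "\<not> Z 0 0 0"
  shows "prime_ideal_in (mspan (rees_exp d b) :: 'k::field mpoly set)
    (mspan (\<lambda>i j n. rees_exp d b i j n \<and> Z i j n))" (is "prime_ideal_in ?A ?P")
proof -
  let ?N = "mspan (\<lambda>i j n. rees_exp d b i j n \<and> \<not> Z i j n) :: 'k mpoly set"
  have PA: "?P \<subseteq> ?A" and NA: "?N \<subseteq> ?A" using mspan_weaken by blast+
  have mult: "a * p \<in> ?P" if "a \<in> ?A" "p \<in> ?P" for a p
    using _ that by (rule mspan_mult) (auto simp: Z rees_exp_add)
  have one: "1 \<notin> ?P"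
  proof
    assume "1 \<in> ?P"
    from mspan_mcoeff[OF this, of 0 0 0] Z0 show False
      by (simp add: mcoeff_monom flip: monom_zero)
  qed
  have prime: "a \<in> ?P \<or> c \<in> ?P" if ac: "a \<in> ?A" "c \<in> ?A" "a * c \<in> ?P" for a c
  proof -
    have split: "\<exists>u \<in> ?N. \<exists>v \<in> ?P. f = u + v" if "f \<in> ?A" for f
      using that by (intro mspan_split) (erule mspan_weaken, blast)
    obtain u v u' v' where uv: "u \<in> ?N" "v \<in> ?P" "a = u + v" "u' \<in> ?N" "v' \<in> ?P" "c = u' + v'"
      using split[OF ac(1)] split[OF ac(2)] by blast
    have "u * u' = a * c - (c * v + u * v')" using uv by (simp add: algebra_simps)
    also have "\<dots> \<in> ?P"
      using ac(3) mult[OF ac(2) uv(2)] mult[OF subsetD[OF NA uv(1)] uv(5)]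
      by (intro mspan_diff mspan_add)
    finally have P: "u * u' \<in> ?P" .
    have N: "u * u' \<in> ?N" using _ uv(1,4) by (rule mspan_mult) (auto simp: Z rees_exp_add)
    have "u * u' = 0"
    proof (rule ccontr)
      assume "u * u' \<noteq> 0"
      then obtain \<kappa> where "\<kappa> \<in> Poly_Mapping.keys (u * u')" by fastforce
      with P N show False unfolding mspan_def by force
    qed
    then show ?thesis using uv by auto
  qed
  show ?thesis
    unfolding prime_ideal_in_def
    by (intro conjI ballI impI; (rule PA mspan_zero mspan_add mult one prime; assumption)?)
qed

lemma krull_dim_rees_ge: "krull_dim (rees d b :: 'k::field mpoly set) \<ge> 3"
proof -
  \<comment> \<open>\<open>Z 0\<close> gives the zero ideal. The strict inclusions are witnessed by
    \<open>x\<close>, \<open>y^d t\<close> and \<open>y\<close>.\<close>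
  define Z where "Z m i j n \<longleftrightarrow> (if m = 0 then False else if m = 1 then i \<noteq> 0
    else if m = 2 then i \<noteq> 0 \<or> n \<noteq> 0 else i \<noteq> 0 \<or> j \<noteq> 0 \<or> n \<noteq> 0)" for m i j n :: nat
  define P where "P m = (mspan (\<lambda>i j n. rees_exp d b i j n \<and> Z m i j n) :: 'k mpoly set)" for m
  have prime: "prime_ideal_in (rees d b) (P m)" for m
    unfolding rees_eq_mspan P_def by (rule prime_ideal_mspan) (auto simp: Z_def)
  have sub: "P m \<subset> P (Suc m)"
    if "\<And>i j n. Z m i j n \<Longrightarrow> Z (Suc m) i j n" "rees_exp d b i j n" "Z (Suc m) i j n" "\<not> Z m i j n"
    for m i j n
  proof (rule psubsetI)
    show "P m \<subseteq> P (Suc m)" unfolding P_def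
      by (rule subsetI, erule mspan_weaken) (use that(1) in blast)
    have "monom i j n \<in> P (Suc m)" unfolding P_def using that by (intro mspan_monom) simp
    moreover have "monom i j n \<notin> P m"
    proof
      assume "monom i j n \<in> P m"
      from mspan_mcoeff[OF this[unfolded P_def], of i j n] that(4) show False
        by (simp add: mcoeff_monom)
    qed
    ultimately show "P m \<noteq> P (Suc m)" by blast
  qed
  have P0: "P 0 \<subset> P (Suc 0)" by (rule sub[of 0 1 0 0]) (simp_all add: Z_def)
  have P1: "P 1 \<subset> P (Suc 1)" by (rule sub[of 1 0 d 1]) (use rees_exp_gens in \<open>simp_all add: Z_def\<close>)
  have P2: "P 2 \<subset> P (Suc 2)" by (rule sub[of 2 0 1 0]) (auto simp: Z_def)
  have "P m \<subset> P (Suc m)" if "m < 3" for m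
  proof -
    from that consider "m = 0" | "m = 1" | "m = 2" by linarith
    then show ?thesis using P0 P1 P2 by cases simp_all
  qed
  then have "enat 3 \<le> krull_dim (rees d b :: 'k mpoly set)"
    unfolding krull_dim_def using prime by (intro Sup_upper CollectI exI[of _ 3] conjI exI[of _ P]) simp_all
  then show ?thesis by (simp add: numeral_eq_enat)
qed

section \<open>Algebraic dependence bounds depth and dimension\<close>

definition list_monom :: "'a::comm_monoid_mult list \<Rightarrow> nat list \<Rightarrow> 'a" where
  "list_monom gs es = prod_list (map2 (^) gs es)"

lemma list_monom_simps [simp]:
  "list_monom [] es = 1" "list_monom (g # gs) (e # es) = g ^ e * list_monom gs es"
  by (simp_all add: list_monom_def)

context k_subalgebra
begin

lemma list_monom_closed: "set gs \<subseteq> A \<Longrightarrow> list_monom gs es \<in> A"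
proof (induction gs arbitrary: es)
  case (Cons g gs)
  then show ?case
    by (cases es) (auto simp: list_monom_def one_closed mult_closed power_closed)
qed (simp add: one_closed)

text \<open>Divide by the lexicographically lowest monomial of the relation: successively, the
  power of \<open>g\<^sub>i\<close> is cancelled modulo \<open>J\<^sub>i\<^sub>-\<^sub>1\<close> and the remaining multiples of \<open>g\<^sub>i\<close> vanish
  modulo \<open>J\<^sub>i\<close>, until only the lowest coefficient is left.\<close>
lemma one_in_last_of_relation:
  assumes "finite E" "E \<noteq> {}" "\<And>es. es \<in> E \<Longrightarrow> length es = length gs"
    and "\<And>es. es \<in> E \<Longrightarrow> c es \<noteq> 0" and "set gs \<subseteq> A"
    and "\<And>i p q. i \<le> length gs \<Longrightarrow> p \<in> J i \<Longrightarrow> q \<in> J i \<Longrightarrow> p + q \<in> J i"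
    and "\<And>i a p. i \<le> length gs \<Longrightarrow> a \<in> A \<Longrightarrow> p \<in> J i \<Longrightarrow> a * p \<in> J i"
    and "\<And>i. i < length gs \<Longrightarrow> J i \<subseteq> J (Suc i)"
    and "\<And>i. i < length gs \<Longrightarrow> gs ! i \<in> J (Suc i)"
    and "\<And>i a. i < length gs \<Longrightarrow> a \<in> A \<Longrightarrow> gs ! i * a \<in> J i \<Longrightarrow> a \<in> J i"
    and "(\<Sum>es \<in> E. Const (c es) * list_monom gs es) \<in> J 0"
  shows "1 \<in> J (length gs)"
  using assms
proof (induction gs arbitrary: J E c)
  case Nil
  have E: "E = {[]}" using Nil.prems(2,3) by auto
  have "Const (1 / c []) * (Const (c []) * 1) \<in> J 0"
    using Nil.prems(7)[of 0 "Const (1 / c [])" "Const (c []) * 1"] Nil.prems(11) Const_closed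
    unfolding E by simp
  moreover have "(Const (1 / c []) * (Const (c []) * 1) :: 'k mpoly) = 1"
    using Nil.prems(4)[of "[]"] E by (simp add: Const_def mult_single)
  ultimately show ?case by simp
next
  case (Cons g gs)
  note finE = Cons.prems(1) and nonE = Cons.prems(2) and lenE = Cons.prems(3)
    and cE = Cons.prems(4)
  have gA: "g \<in> A" "set gs \<subseteq> A" using Cons.prems(5) by auto
  \<comment> \<open>The relation becomes \<open>g^m\<close> times \<open>Q + R g\<close>, where
    \<open>Q\<close> collects the terms in \<open>E0\<close>, those of lowest exponent
    \<open>m\<close> in \<open>g\<close>, and involves only the remaining elements.\<close>
  define m where "m = Min (hd ` E)"
  have m_le: "m \<le> hd es" if "es \<in> E" for es
    unfolding m_def using finE that by simp
  have "m \<in> hd ` E" unfolding m_def using finE nonE by simp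
  define E0 where "E0 = {es \<in> E. hd es = m}"
  define E' where "E' = tl ` E0"
  have E_Cons: "hd es # tl es = es" if "es \<in> E" for es
    using lenE[OF that] by (cases es) auto
  have inj: "inj_on tl E0"
  proof (rule inj_onI)
    fix x y assume *: "x \<in> E0" "y \<in> E0" "tl x = tl y"
    then have "hd x # tl x = hd y # tl y" unfolding E0_def by simp
    moreover have "hd x # tl x = x" "hd y # tl y = y" using * E_Cons unfolding E0_def by blast+
    ultimately show "x = y" by simp
  qed
  define Q where "Q = (\<Sum>ts \<in> E'. Const (c (m # ts)) * list_monom gs ts)"
  \<comment> \<open>Off \<open>E0\<close> the exponent exceeds \<open>m\<close>, so the subtraction
    is not truncated.\<close>
  define R where "R = (\<Sum>es \<in> E - E0. Const (c es) * (g ^ (hd es - m - 1) * list_monom gs (tl es)))"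
  have Q: "(\<Sum>es \<in> E0. Const (c es) * list_monom (g # gs) es) = g ^ m * Q"
  proof -
    have "Q = (\<Sum>es \<in> E0. Const (c (m # tl es)) * list_monom gs (tl es))"
      unfolding Q_def E'_def by (simp add: sum.reindex[OF inj])
    also have "g ^ m * \<dots> = (\<Sum>es \<in> E0. Const (c es) * list_monom (g # gs) es)"
      unfolding sum_distrib_left
    proof (rule sum.cong[OF refl])
      fix es assume "es \<in> E0"
      then have "m # tl es = es" using E_Cons[of es] unfolding E0_def by simp
      then obtain ts where "es = m # ts" by metis
      then show "g ^ m * (Const (c (m # tl es)) * list_monom gs (tl es))
          = Const (c es) * list_monom (g # gs) es"
        by (simp add: mult.left_commute)
    qed
    finally show ?thesis by simp
  qed
  have R: "(\<Sum>es \<in> E - E0. Const (c es) * list_monom (g # gs) es) = g ^ m * (R * g)"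
    unfolding R_def sum_distrib_left sum_distrib_right
  proof (rule sum.cong[OF refl])
    fix es assume es: "es \<in> E - E0"
    then have "hd es = m + (hd es - m - 1) + 1" using m_le[of es] unfolding E0_def by auto
    then have "g ^ hd es = g ^ m * g ^ (hd es - m - 1) * g"
      by (metis power_add power_one_right)
    moreover have "list_monom (g # gs) es = g ^ hd es * list_monom gs (tl es)"
      using lenE[of es] es by (cases es) auto
    ultimately show "Const (c es) * list_monom (g # gs) es
        = g ^ m * (Const (c es) * (g ^ (hd es - m - 1) * list_monom gs (tl es)) * g)"
      by (simp add: ac_simps)
  qed
  have QA: "Q \<in> A" unfolding Q_def using gA
    by (intro sum_closed mult_closed Const_closed list_monom_closed)
  have RA: "R \<in> A" unfolding R_def using gA
    by (intro sum_closed mult_closed Const_closed list_monom_closed power_closed)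
  have "(\<Sum>es \<in> E. Const (c es) * list_monom (g # gs) es) = g ^ m * (Q + R * g)"
    using sum.subset_diff[of E0 E "\<lambda>es. Const (c es) * list_monom (g # gs) es"] Q R finE
    unfolding E0_def by (simp add: distrib_left add.commute)
  then have "g ^ m * (Q + R * g) \<in> J 0" using Cons.prems(11) by simp
  moreover have "a \<in> J 0" if "g ^ m' * a \<in> J 0" "a \<in> A" for m' a
    using that
  proof (induction m')
    case (Suc m')
    then have "g ^ m' * a \<in> J 0"
      using Cons.prems(10)[of 0 "g ^ m' * a"] gA by (simp add: mult_closed power_closed mult.assoc)
    with Suc show ?case by simp
  qed simp
  ultimately have "Q + R * g \<in> J 0" using QA RA gA by (simp add: add_closed mult_closed)
  then have J1: "Q + R * g \<in> J 1" using Cons.prems(8)[of 0] by auto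
  have "- R * g \<in> J 1"
    using Cons.prems(7)[of 1 "- R" g] Cons.prems(9)[of 0] RA by (simp add: uminus_closed)
  from Cons.prems(6)[OF _ J1 this] have "(Q + R * g) + (- R * g) \<in> J 1" by simp
  then have "Q \<in> J (Suc 0)" by simp
  have "1 \<in> J (Suc (length gs))"
  \<comment> \<open>The induction hypothesis is applied to the chain shifted by one, with
    \<open>Q\<close> as the new relation modulo \<open>J 1\<close>.\<close>
  proof (rule Cons.IH[of E' "\<lambda>ts. c (m # ts)" "\<lambda>i. J (Suc i)"])
    show "finite E'" unfolding E'_def E0_def using finE by simp
    show "E' \<noteq> {}" using \<open>m \<in> hd ` E\<close> unfolding E'_def E0_def by auto
    show "length ts = length gs" if "ts \<in> E'" for ts
      using that lenE unfolding E'_def E0_def by auto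
    show "c (m # ts) \<noteq> 0" if ts: "ts \<in> E'" for ts
    proof -
      obtain es where "es \<in> E" "hd es = m" "ts = tl es" using ts unfolding E'_def E0_def by auto
      with E_Cons[of es] cE[of es] show ?thesis by metis
    qed
    show "set gs \<subseteq> A" by (rule gA)
    show "p + q \<in> J (Suc i)" if "i \<le> length gs" "p \<in> J (Suc i)" "q \<in> J (Suc i)" for i p q
      using Cons.prems(6)[of "Suc i" p q] that by simp
    show "a * p \<in> J (Suc i)" if "i \<le> length gs" "a \<in> A" "p \<in> J (Suc i)" for i a p
      using Cons.prems(7)[of "Suc i" a p] that by simp
    show "J (Suc i) \<subseteq> J (Suc (Suc i))" if "i < length gs" for i
      using Cons.prems(8)[of "Suc i"] that by simp
    show "gs ! i \<in> J (Suc (Suc i))" if "i < length gs" for i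
      using Cons.prems(9)[of "Suc i"] that by simp
    show "a \<in> J (Suc i)" if "i < length gs" "a \<in> A" "gs ! i * a \<in> J (Suc i)" for i a
      using Cons.prems(10)[of "Suc i" a] that by simp
    show "(\<Sum>ts \<in> E'. Const (c (m # ts)) * list_monom gs ts) \<in> J (Suc 0)"
      using \<open>Q \<in> J (Suc 0)\<close> unfolding Q_def .
  qed
  then show ?case by simp
qed

end

section \<open>Degree boxes and algebraic dependence of four polynomials\<close>

abbreviation box :: "nat \<Rightarrow> nat \<Rightarrow> nat \<Rightarrow> nat \<Rightarrow> bool" where
  "box D i j n \<equiv> i \<le> D \<and> j \<le> D \<and> n \<le> D"

lemma mspan_bounded:
  assumes "p \<in> mspan Q"
  shows "\<exists>D. p \<in> mspan (box D)"
  using assms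
proof (induction rule: mspan_induct)
  case zero
  show ?case using mspan_zero by blast
next
  case (add p q)
  then obtain D D' where "p \<in> mspan (box D)" "q \<in> mspan (box D')" by blast
  then have "p \<in> mspan (box (max D D'))" "q \<in> mspan (box (max D D'))"
    by (auto elim!: mspan_weaken)
  then show ?case using mspan_add by blast
next
  case (monom c i j n)
  have "Const c * monom i j n \<in> mspan (box (max i (max j n)))" by (rule mspan_Const_monom) auto
  then show ?case by blast
qed

lemma mspan_bounded_list:
  assumes "set gs \<subseteq> mspan Q"
  shows "\<exists>D. set gs \<subseteq> mspan (box D)"
  using assms
proof (induction gs)
  case (Cons g gs)
  then obtain D D' where D: "g \<in> mspan (box D)" "set gs \<subseteq> mspan (box D')"
    using mspan_bounded[of g Q] by auto
  have "mspan (box D) \<subseteq> mspan (box (max D D'))" "mspan (box D') \<subseteq> mspan (box (max D D'))"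
    by (auto elim!: mspan_weaken)
  with D have "set (g # gs) \<subseteq> mspan (box (max D D'))" by auto
  then show ?case by blast
qed simp

lemma mspan_box_mult: "p \<in> mspan (box D) \<Longrightarrow> q \<in> mspan (box D') \<Longrightarrow> p * q \<in> mspan (box (D + D'))"
  by (rule mspan_mult) auto

lemma one_mspan_box: "1 \<in> mspan (box D)"
  using mspan_monom[of "box D" 0 0 0] by (simp add: monom_zero)

lemma mspan_box_power: "p \<in> mspan (box D) \<Longrightarrow> p ^ e \<in> mspan (box (D * e))"
proof (induction e)
  case (Suc e)
  then show ?case using mspan_box_mult[of p D "p ^ e" "D * e"] by simp
qed (use one_mspan_box[of 0] in simp)

lemma list_monom_box:
  assumes "set gs \<subseteq> mspan (box D)" "length es = length gs" "set es \<subseteq> {..N}"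
  shows "list_monom gs es \<in> mspan (box (D * (length gs * N)))"
  using assms(2,1,3)
proof (induction es gs rule: list_induct2)
  case Nil
  show ?case using one_mspan_box[of 0] by simp
next
  case (Cons e es g gs)
  have "g ^ e \<in> mspan (box (D * e))" using Cons.prems by (intro mspan_box_power) simp
  moreover have "list_monom gs es \<in> mspan (box (D * (length gs * N)))" using Cons by simp
  ultimately have "list_monom (g # gs) (e # es) \<in> mspan (box (D * e + D * (length gs * N)))"
    by (simp add: mspan_box_mult)
  moreover have "D * e + D * (length gs * N) \<le> D * (length (g # gs) * N)"
    using Cons.prems by (simp add: distrib_left)
  ultimately show ?case by (elim mspan_weaken) auto
qed

lemma vector_space_mpoly: "vector_space (\<lambda>(c::'k::field) (p::'k mpoly). Const c * p)"
proof
  fix a b :: 'k and x y :: "'k mpoly"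
  show "Const a * (x + y) = Const a * x + Const a * y" by (simp add: distrib_left)
  show "Const (a + b) * x = Const a * x + Const b * x"
    by (simp add: Const_def single_add distrib_right)
  show "Const a * (Const b * x) = Const (a * b) * x"
    by (simp add: Const_def mult_single flip: mult.assoc)
  show "Const 1 * x = x" by (simp add: Const_def)
qed

text \<open>The \<open>(N + 1)\<^sup>4\<close> monomials in four polynomials with exponents at most \<open>N\<close> lie in a space
  of dimension \<open>O(N\<^sup>3)\<close>.\<close>
lemma four_polys_dependent:
  fixes gs :: "'k::field mpoly list"
  assumes gs: "set gs \<subseteq> mspan Q" and len: "length gs = 4"
  shows "\<exists>E c. finite E \<and> E \<noteq> {} \<and> (\<forall>es \<in> E. length es = length gs) \<and> (\<forall>es \<in> E. c es \<noteq> 0)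
    \<and> (\<Sum>es \<in> E. Const (c es) * list_monom gs es) = 0"
proof -
  interpret vs: vector_space "\<lambda>(c::'k) (p::'k mpoly). Const c * p" by (rule vector_space_mpoly)
  obtain D where D: "set gs \<subseteq> mspan (box D)" using mspan_bounded_list[OF gs] by blast
  \<comment> \<open>The power products have degree at most \<open>K = 4DN\<close> in each variable,
    and \<open>K + 1 \<le> (4D + 1) N\<close>. With this \<open>N\<close> the cube of the right side
    is exactly \<open>N^4\<close>, less than the number \<open>(N + 1)^4\<close> of exponent
    vectors.\<close>
  define N where "N = (4 * D + 1) ^ 3"
  define L where "L = {es. set es \<subseteq> {..N} \<and> length es = 4}"
  have finL: "finite L" unfolding L_def by (rule finite_lists_length_eq) simp
  have cardL: "card L = Suc N ^ 4" unfolding L_def by (simp add: card_lists_length_eq)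
  show ?thesis
  \<comment> \<open>Two coinciding power products already give a relation. Otherwise linear
    dependence of the set of products pulls back to distinct exponent vectors.\<close>
  proof (cases "inj_on (list_monom gs) L")
    case False
    then obtain es es' where es: "es \<in> L" "es' \<in> L" "es \<noteq> es'" "list_monom gs es = list_monom gs es'"
      unfolding inj_on_def by blast
    define c where "c fs = (if fs = es then 1 else - 1 :: 'k)" for fs
    have "(\<Sum>fs \<in> {es, es'}. Const (c fs) * list_monom gs fs) = 0"
      using es by (simp add: c_def Const_def single_uminus)
    moreover have "\<forall>fs \<in> {es, es'}. length fs = length gs" "\<forall>fs \<in> {es, es'}. c fs \<noteq> 0"
      using es len by (auto simp: L_def c_def)
    ultimately show ?thesis by (intro exI[of _ "{es, es'}"] exI[of _ c]) simp
  next
    case True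
    define K where "K = D * (4 * N)"
    define B where "B = (\<lambda>(i, j, n). monom i j n :: 'k mpoly) ` ({..K} \<times> {..K} \<times> {..K})"
    have "card B \<le> card ({..K} \<times> {..K} \<times> {..K})" unfolding B_def by (rule card_image_le) simp
    also have "\<dots> = (K + 1) ^ 3" by (simp add: card_cartesian_product power3_eq_cube)
    also have "\<dots> \<le> ((4 * D + 1) * N) ^ 3"
      by (rule power_mono) (simp_all add: K_def N_def)
    also have "\<dots> = N ^ 4" unfolding power_mult_distrib N_def[symmetric]
      by (simp add: numeral_eq_Suc)
    also have "\<dots> < Suc N ^ 4" by (rule power_strict_mono) auto
    finally have card: "card B < card (list_monom gs ` L)"
      using cardL by (simp add: card_image[OF True])
    have span: "p \<in> vs.span B" if "p \<in> mspan (box K)" for p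
      using that
    proof (induction rule: mspan_induct)
      case (monom c i j n)
      then have "monom i j n \<in> B" unfolding B_def by force
      then show ?case by (intro vs.span_scale vs.span_base)
    qed (auto intro: vs.span_zero vs.span_add)
    have sub: "list_monom gs ` L \<subseteq> vs.span B"
    proof (rule image_subsetI)
      fix es assume "es \<in> L"
      then have "list_monom gs es \<in> mspan (box K)"
        using list_monom_box[OF D, of es N] len unfolding L_def K_def by simp
      then show "list_monom gs es \<in> vs.span B" by (rule span)
    qed
    have "finite B" unfolding B_def by simp
    with sub card have "vs.dependent (list_monom gs ` L)"
      using vs.independent_span_bound[of B "list_monom gs ` L"] by auto
    then obtain u where u: "\<exists>v \<in> list_monom gs ` L. u v \<noteq> 0"
      "(\<Sum>v \<in> list_monom gs ` L. Const (u v) * v) = 0"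
      using vs.dependent_finite[of "list_monom gs ` L"] finL by auto
    \<comment> \<open>Zero coefficients are dropped because \<open>one_in_last_of_relation\<close>
      inverts the coefficient it ends with.\<close>
    define E where "E = {es \<in> L. u (list_monom gs es) \<noteq> 0}"
    have "(\<Sum>es \<in> E. Const (u (list_monom gs es)) * list_monom gs es)
        = (\<Sum>es \<in> L. Const (u (list_monom gs es)) * list_monom gs es)"
      by (rule sum.mono_neutral_left) (auto simp: E_def finL Const_def)
    also have "\<dots> = 0" using u(2) by (simp add: sum.reindex[OF True])
    finally have "(\<Sum>es \<in> E. Const (u (list_monom gs es)) * list_monom gs es) = 0" .
    moreover have "finite E" using finL by (simp add: E_def)
    moreover have "E \<noteq> {}" "\<forall>es \<in> E. length es = length gs"
      using u(1) len by (auto simp: E_def L_def)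
    ultimately show ?thesis
      by (intro exI[of _ E] exI[of _ "\<lambda>es. u (list_monom gs es)"]) (simp add: E_def)
  qed
qed

section \<open>Upper bounds for depth and dimension\<close>

context k_subalgebra
begin

text \<open>A relation among four elements of the sequence is fed to
  \<open>one_in_last_of_relation\<close>, with \<open>J i\<close> generated by the first
  \<open>i\<close> of them. Regularity is the cancellation property, and \<open>1\<close> would lie
  in the ideal of the sequence.\<close>

lemma regular_seq_length_le_3:
  assumes "A \<subseteq> mspan Q" "M \<subseteq> A" "regular_seq A M fs"
  shows "length fs \<le> 3"
proof (rule ccontr)
  assume len: "\<not> length fs \<le> 3"
  define gs where "gs = take 4 fs"
  have lengs: "length gs = 4" using len by (simp add: gs_def)
  have gsA: "set gs \<subseteq> A"
    using assms(2,3) set_take_subset[of 4 fs] unfolding regular_seq_def gs_def by blast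
  obtain E c where E: "finite E" "E \<noteq> {}" "\<forall>es \<in> E. length es = length gs" "\<forall>es \<in> E. c es \<noteq> 0"
    "(\<Sum>es \<in> E. Const (c es) * list_monom gs es) = 0"
    using four_polys_dependent[of gs Q] gsA assms(1) lengs by blast
  let ?J = "\<lambda>i. ideal_gen A (set (take i fs))"
  have gs_nth: "gs ! i = fs ! i" if "i < length gs" for i
    using that unfolding gs_def by simp
  have "1 \<in> ?J (length gs)"
  proof (rule one_in_last_of_relation[of E gs c ?J])
    fix i assume i: "i < length gs"
    show "?J i \<subseteq> ?J (Suc i)"
      by (rule subsetI, rule ideal_gen_mono[OF set_take_subset_set_take]) simp_all
    have "fs ! i \<in> set (take (Suc i) fs)"
      using i lengs len by (simp add: take_Suc_conv_app_nth)
    then show "gs ! i \<in> ?J (Suc i)" using gs_nth[OF i] ideal_gen_gen by simp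
    show "a \<in> ?J i" if "a \<in> A" "gs ! i * a \<in> ?J i" for a
      using assms(3) that i lengs len unfolding gs_nth[OF i] regular_seq_def by auto
  next
    show "(\<Sum>es \<in> E. Const (c es) * list_monom gs es) \<in> ?J 0"
      using E(5) ideal_gen.zero by simp
  qed (use E gsA in \<open>auto intro: ideal_gen_add ideal_gen_mult\<close>)
  then have "1 \<in> ideal_gen A (set fs)"
    using ideal_gen_mono[OF set_take_subset] by blast
  with assms(3) show False unfolding regular_seq_def by blast
qed

text \<open>The same argument with \<open>J i\<close> the \<open>i\<close>-th prime of a chain and
  one element chosen from each step \<open>P (Suc i) - P i\<close>. Cancellation holds because that
  element lies outside the prime \<open>P i\<close>.\<close>

lemma krull_dim_le_3:
  assumes "A \<subseteq> mspan Q"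
  shows "krull_dim A \<le> 3"
  unfolding krull_dim_def
proof (rule Sup_least, elim CollectE exE conjE)
  fix e m P assume e: "e = enat m" and prime: "\<forall>i \<le> m. prime_ideal_in A (P i)"
    and chain: "\<forall>i < m. P i \<subset> P (Suc i)"
  have "m \<le> 3"
  proof (rule ccontr)
    assume m: "\<not> m \<le> 3"
    have "\<exists>g. \<forall>i < m. g i \<in> P (Suc i) - P i"
      using chain by (intro choice allI) blast
    then obtain g where g: "\<And>i. i < m \<Longrightarrow> g i \<in> P (Suc i)" "\<And>i. i < m \<Longrightarrow> g i \<notin> P i" by blast
    define gs where "gs = map g [0..<4]"
    have lengs: "length gs = 4" by (simp add: gs_def)
    have gs_nth: "gs ! i = g i" if "i < 4" for i using that by (simp add: gs_def)
    have PA: "P i \<subseteq> A" if "i \<le> m" for i using prime that unfolding prime_ideal_in_def by blast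
    have gA: "g i \<in> A" if "i < 4" for i using g(1)[of i] PA[of "Suc i"] that m by auto
    have gsA: "set gs \<subseteq> A" using gA unfolding gs_def by auto
    obtain E c where E: "finite E" "E \<noteq> {}" "\<forall>es \<in> E. length es = length gs" "\<forall>es \<in> E. c es \<noteq> 0"
      "(\<Sum>es \<in> E. Const (c es) * list_monom gs es) = 0"
      using four_polys_dependent[of gs Q] gsA assms(1) lengs by blast
    have pr: "prime_ideal_in A (P i)" if "i \<le> 4" for i using prime that m by simp
    have "1 \<in> P (length gs)"
    proof (rule one_in_last_of_relation[of E gs c P])
      fix i assume "i < length gs"
      then have i: "i < 4" "i < m" using lengs m by auto
      show "P i \<subseteq> P (Suc i)" using chain i by blast
      show "gs ! i \<in> P (Suc i)" using g(1) i gs_nth by simp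
      show "a \<in> P i" if "a \<in> A" "gs ! i * a \<in> P i" for a
        using pr[of i] that g(2)[of i] gA[of i] i unfolding gs_nth[OF i(1)] prime_ideal_in_def by auto
    next
      show "(\<Sum>es \<in> E. Const (c es) * list_monom gs es) \<in> P 0"
        using E(5) pr[of 0] unfolding prime_ideal_in_def by simp
    next
      fix i p q assume "i \<le> length gs" "p \<in> P i" "q \<in> P i"
      then show "p + q \<in> P i" using pr[of i] lengs unfolding prime_ideal_in_def by simp
    next
      fix i a p assume "i \<le> length gs" "a \<in> A" "p \<in> P i"
      then show "a * p \<in> P i" using pr[of i] lengs unfolding prime_ideal_in_def by simp
    qed (use E gsA in auto)
    with pr[of 4] show False unfolding lengs prime_ideal_in_def by simp
  qed
  with e show "e \<le> 3" by (simp add: numeral_eq_enat)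
qed

end


theorem mainTheorem8:
  fixes d b :: nat
  assumes "d \<ge> 2" and "1 \<le> b" and "b \<le> d - b" and "gcd d b = 1"
  shows "almost_CM (rees d b :: 'k::field mpoly set) (rees_max d b)
       \<and> (CM (rees d b :: 'k::field mpoly set) (rees_max d b) \<longleftrightarrow> d = 2)"
proof -
  let ?A = "rees d b :: 'k mpoly set" and ?M = "rees_max d b :: 'k mpoly set"
  interpret k_subalgebra ?A unfolding rees_eq_mspan by (rule rees_subalgebra)
  have A_subset: "?A \<subseteq> mspan (rees_exp d b)" unfolding rees_eq_mspan ..
  have MA: "?M \<subseteq> ?A"
    unfolding rees_eq_mspan
    by (rule subset_trans[OF rees_max_subset], rule subsetI, erule mspan_weaken)
      (simp add: rees_exp_pos_def)
  have depth_ge: "enat (length fs) \<le> depth ?A ?M" if "regular_seq ?A ?M fs" for fs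
    unfolding depth_def using that by (intro Sup_upper) blast
  have depth_le: "depth ?A ?M \<le> enat m" if "\<And>fs. regular_seq ?A ?M fs \<Longrightarrow> length fs \<le> m" for m
    unfolding depth_def using that by (intro Sup_least) auto
  have two: "2 \<le> depth ?A ?M"
    using depth_ge[OF regular_seq_rees_pair[of b d]] assms
    by (simp add: numeral_eq_enat numeral_2_eq_2)
  have dim_ge: "3 \<le> krull_dim ?A" by (rule krull_dim_rees_ge)
  have "CM ?A ?M \<longleftrightarrow> d = 2"
  proof (cases "d = 2")
    case True
    then have b: "b = 1" using assms by simp
    have dim: "krull_dim ?A = 3"
      by (rule antisym[OF krull_dim_le_3[OF A_subset] dim_ge])
    have "depth ?A ?M \<le> 3"
      unfolding numeral_eq_enat
      by (rule depth_le, rule regular_seq_length_le_3[OF A_subset MA])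
    moreover have "3 \<le> depth ?A ?M"
      using depth_ge[OF regular_seq_rees_triple[folded True b]]
      by (simp add: numeral_eq_enat numeral_3_eq_3)
    ultimately show ?thesis unfolding CM_def using True dim by simp
  next
    case False
    \<comment> \<open>Equality would make \<open>b\<close> a divisor of \<open>d\<close>, so
      \<open>b = 1\<close> by coprimality and \<open>d = 2\<close>.\<close>
    have "2 * b \<noteq> d"
    proof
      assume "2 * b = d"
      then have "b dvd d" by (metis dvd_triv_right)
      then have "b = 1" using assms(4) by (metis gcd_nat.absorb2)
      with \<open>2 * b = d\<close> False show False by simp
    qed
    then have "2 * b < d" using assms by linarith
    then have "depth ?A ?M \<le> 2"
      unfolding numeral_eq_enat
      by (intro depth_le regular_seq_rees_length[OF _ assms(2)])
    also have "(2 :: enat) < 3" by simp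
    finally show ?thesis unfolding CM_def using False dim_ge by auto
  qed
  with two show ?thesis unfolding almost_CM_def by blast
qed

end
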